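(* Let $M$ be a matroid of rank $r$ on a finite set $E$ with $|E|=2r$. Then $\omega(M)$ is either $1$ or $0$. More specifically, let $M_1,\dots,M_c$ be the connected components of $M$, with ground sets $E_1,\dots,E_c$. Then $\omega(M)=1$ if every $M_i$ satisfies $|E_i|=2\operatorname{rank}(M_i)$ and has no proper nonempty crowded subsets, and $\omega(M)=0$ otherwise.
   Context: For a matroid $N$ on a set $E'$, a subset $S\subseteq E'$ is crowded if $|S|-2\operatorname{rank}_N(S)\ge0$. Let $M$ be a matroid of rank $r$ on a finite set $E$, $|E|=n$, and let $c(M)$ be its number of connected components. Speyer's $g$-polynomial $g_M(t)\in\mathbb Z[t]$ is given as follows (in the form of Berget–Eur–Spink–Tseng, equivalent to the original $K$-theoretic definition). If $E=\emptyset$, $g_M=1$. If $M$ has a loop or a coloop, $g_M=0$. Otherwise, for each total ordering $w=(w_1,\dots,w_n)$ of $E$, let $B_w$ be the basis with $w_k\in B_w$ iff $\operatorname{rank}\{w_1,\dots,w_k\}>\operatorname{rank}\{w_1,\dots,w_{k-1}\}$. In $\mathbb Z[z_e:e\in E]$, let $x^w$ be the list of the $z_b$, $b\in B_w$; let $y^w$ be the list of the $-z_c$, $c\in E\setminus B_w$; let $\alpha^w=-z_{w_n}$. For a family $f=(f_w)_w$ put $\deg f=\sum_w f_w/\prod_{i=1}^{n-1}(z_{w_i}-z_{w_{i+1}})$. With $\boldsymbol e_k$ the $k$-th elementary symmetric polynomial, $$g_M(t)=(-1)^{c(M)}\sum_{i=1}^{r}(-t)^i\sum_{j=0}^{i-1}\deg\big(\alpha^j\,\boldsymbol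 e_{i-j-1}(-y)\,\boldsymbol e_{r-i}(x)\,\boldsymbol e_{n-r}(y)\big).$$ $\omega(M)$ is the coefficient of $t^r$ in $g_M(t)$. *)

theory Defs
  imports
    "HOL-Library.Poly_Mapping"
    "HOL-Computational_Algebra.Polynomial"
    "HOL-Computational_Algebra.Fraction_Field"
    "HOL-Combinatorics.Multiset_Permutations"
begin

section \<open>Matroids\<close>

locale matroid =
  fixes E :: "'a set" and indep :: "'a set \<Rightarrow> bool"
  assumes finite_ground: "finite E"
    and indep_subset_ground: "indep X \<Longrightarrow> X \<subseteq> E"
    and indep_empty: "indep {}"
    and indep_mono: "indep X \<Longrightarrow> Y \<subseteq> X \<Longrightarrow> indep Y"
    and indep_augment:
      "indep X \<Longrightarrow> indep Y \<Longrightarrow> card X < card Y \<Longrightarrow> \<exists>e\<in>Y - X. indep (insert e X)"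

definition matroid_rank :: "('a set \<Rightarrow> bool) \<Rightarrow> 'a set \<Rightarrow> nat" where
  "matroid_rank indep S = Max {card X | X. X \<subseteq> S \<and> indep X}"

definition matroid_basis :: "('a set \<Rightarrow> bool) \<Rightarrow> 'a set \<Rightarrow> bool" where
  "matroid_basis indep B \<longleftrightarrow> indep B \<and> (\<forall>X. indep X \<longrightarrow> B \<subseteq> X \<longrightarrow> X = B)"

definition is_loop :: "'a set \<Rightarrow> ('a set \<Rightarrow> bool) \<Rightarrow> 'a \<Rightarrow> bool" where
  "is_loop E indep e \<longleftrightarrow> e \<in> E \<and> \<not> indep {e}"

definition is_coloop :: "'a set \<Rightarrow> ('a set \<Rightarrow> bool) \<Rightarrow> 'a \<Rightarrow> bool" where
  "is_coloop E indep e \<longleftrightarrow> e \<in> E \<and> (\<forall>B. matroid_basis indep B \<longrightarrow> e \<in> B)"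

text \<open>Independence in the restriction of a matroid to the ground set \<open>T\<close>.\<close>

definition restriction :: "('a set \<Rightarrow> bool) \<Rightarrow> 'a set \<Rightarrow> 'a set \<Rightarrow> bool" where
  "restriction indep T X \<longleftrightarrow> X \<subseteq> T \<and> indep X"

text \<open>\<open>T\<close> is a direct summand if the matroid is the direct sum of its restrictions to \<open>T\<close>
  and to \<open>E - T\<close>. The connected components are given by their ground sets.\<close>

definition direct_summand :: "'a set \<Rightarrow> ('a set \<Rightarrow> bool) \<Rightarrow> 'a set \<Rightarrow> bool" where
  "direct_summand E indep T \<longleftrightarrow> T \<subseteq> E \<and>
     (\<forall>X. X \<subseteq> E \<longrightarrow>
        (indep X \<longleftrightarrow> restriction indep T (X \<inter> T) \<and> restriction indep (E - T) (X - T)))"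

definition matroid_connected :: "'a set \<Rightarrow> ('a set \<Rightarrow> bool) \<Rightarrow> bool" where
  "matroid_connected E indep \<longleftrightarrow> (\<forall>T. direct_summand E indep T \<longrightarrow> T = {} \<or> T = E)"

definition components :: "'a set \<Rightarrow> ('a set \<Rightarrow> bool) \<Rightarrow> 'a set set" where
  "components E indep =
     {C. C \<noteq> {} \<and> direct_summand E indep C \<and> matroid_connected C (restriction indep C)}"

definition crowded :: "'a set \<Rightarrow> ('a set \<Rightarrow> bool) \<Rightarrow> 'a set \<Rightarrow> bool" where
  "crowded E indep S \<longleftrightarrow> S \<subseteq> E \<and> int (card S) - 2 * int (matroid_rank indep S) \<ge> 0"


section \<open>The polynomial ring over the integers in variables indexed by a type\<close>

text \<open>The library shows that polynomials of type \<^typ>\<open>('a \<Rightarrow>\<^sub>0 nat) \<Rightarrow>\<^sub>0 int\<close> have no zero divisors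
  only for linearly ordered \<open>'a\<close>. We want the fraction field for arbitrary \<open>'a\<close>, hence a new type.\<close>

typedef 'a zpoly = "UNIV :: (('a \<Rightarrow>\<^sub>0 nat) \<Rightarrow>\<^sub>0 int) set"
  morphisms rep_zpoly abs_zpoly ..

setup_lifting type_definition_zpoly

lift_definition zvar :: "'a \<Rightarrow> 'a zpoly" is
  "\<lambda>a. Poly_Mapping.single (Poly_Mapping.single a 1) 1" .

lemma unique_sum_pair:
  fixes A B :: "('a \<Rightarrow>\<^sub>0 nat) set"
  assumes "finite A" "finite B" "A \<noteq> {}" "B \<noteq> {}"
  shows "\<exists>a\<in>A. \<exists>b\<in>B. \<forall>a'\<in>A. \<forall>b'\<in>B. a' + b' = a + b \<longrightarrow> a' = a \<and> b' = b"
  using assms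
proof (induction "card A + card B" arbitrary: A B rule: less_induct)
  case less
  show ?case
  proof (cases "(\<exists>a. A = {a}) \<and> (\<exists>b. B = {b})")
    case True
    then show ?thesis by auto
  next
    case False
    then obtain m m' where m: "m \<noteq> m'" "(m \<in> A \<and> m' \<in> A) \<or> (m \<in> B \<and> m' \<in> B)"
      using less.prems by blast
    then obtain v where v: "Poly_Mapping.lookup m v \<noteq> Poly_Mapping.lookup m' v"
      using poly_mapping_eqI[of m m'] by blast
    define top where "top = (\<lambda>C::('a \<Rightarrow>\<^sub>0 nat) set. Max ((\<lambda>c. Poly_Mapping.lookup c v) ` C))"
    define upper where "upper = (\<lambda>C::('a \<Rightarrow>\<^sub>0 nat) set. {c \<in> C. Poly_Mapping.lookup c v = top C})"
    have le_top: "Poly_Mapping.lookup c v \<le> top C" if "finite C" "c \<in> C" for C c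
      using that by (simp add: top_def)
    have upper_sub: "upper C \<subseteq> C" for C
      by (auto simp: upper_def)
    have upper_ne: "upper C \<noteq> {}" if "finite C" "C \<noteq> {}" for C
    proof -
      have "top C \<in> (\<lambda>c. Poly_Mapping.lookup c v) ` C"
        unfolding top_def using that by (intro Max_in) auto
      then show ?thesis by (auto simp: upper_def)
    qed
    have fin: "finite (upper A)" "finite (upper B)"
      using less.prems upper_sub finite_subset by blast+
    have "upper A \<noteq> A \<or> upper B \<noteq> B"
    proof (rule ccontr)
      assume "\<not> (upper A \<noteq> A \<or> upper B \<noteq> B)"
      then have "\<forall>c\<in>A. Poly_Mapping.lookup c v = top A" "\<forall>c\<in>B. Poly_Mapping.lookup c v = top B"
        unfolding upper_def by blast+
      with m v show False by auto
    qed
    then have "card (upper A) < card A \<or> card (upper B) < card B"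
      using upper_sub less.prems by (meson psubsetI psubset_card_mono)
    moreover have "card (upper A) \<le> card A" "card (upper B) \<le> card B"
      using less.prems upper_sub by (metis card_mono)+
    ultimately have "card (upper A) + card (upper B) < card A + card B"
      by linarith
    from less.hyps[OF this fin upper_ne upper_ne] less.prems
    obtain a b where ab: "a \<in> upper A" "b \<in> upper B"
      and uniq: "\<And>a' b'. a' \<in> upper A \<Longrightarrow> b' \<in> upper B \<Longrightarrow> a' + b' = a + b \<Longrightarrow> a' = a \<and> b' = b"
      by blast
    have "a' = a \<and> b' = b" if "a' \<in> A" "b' \<in> B" "a' + b' = a + b" for a' b'
    proof -
      have "Poly_Mapping.lookup a' v + Poly_Mapping.lookup b' v = Poly_Mapping.lookup a v + Poly_Mapping.lookup b v"
        using that(3) by (metis lookup_add)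
      moreover have "Poly_Mapping.lookup a v = top A" "Poly_Mapping.lookup b v = top B"
        using ab by (auto simp: upper_def)
      ultimately have "Poly_Mapping.lookup a' v = top A" "Poly_Mapping.lookup b' v = top B"
        using le_top[of A a'] le_top[of B b'] that less.prems by linarith+
      then show ?thesis using that uniq by (auto simp: upper_def)
    qed
    then show ?thesis using ab upper_sub by blast
  qed
qed

lemma poly_mapping_mult_nonzero:
  fixes p q :: "('a \<Rightarrow>\<^sub>0 nat) \<Rightarrow>\<^sub>0 int"
  assumes "p \<noteq> 0" "q \<noteq> 0"
  shows "p * q \<noteq> 0"
proof -
  obtain a b where ab: "a \<in> Poly_Mapping.keys p" "b \<in> Poly_Mapping.keys q"
    and uniq: "\<And>a' b'. a' \<in> Poly_Mapping.keys p \<Longrightarrow> b' \<in> Poly_Mapping.keys q \<Longrightarrow> a' + b' = a + b \<Longrightarrow> a' = a \<and> b' = b"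
    using unique_sum_pair[of "Poly_Mapping.keys p" "Poly_Mapping.keys q"] assms by (auto simp: keys_eq_empty)
  have fin: "finite {(a', b'). Poly_Mapping.lookup p a' * Poly_Mapping.lookup q b' \<noteq> 0}"
    by (rule finite_subset[of _ "Poly_Mapping.keys p \<times> Poly_Mapping.keys q"]) (auto simp: in_keys_iff)
  have "Poly_Mapping.lookup (p * q) (a + b) =
      (\<Sum>(a', b'). Poly_Mapping.lookup p a' * Poly_Mapping.lookup q b' when a + b = a' + b')"
    by (simp add: times_poly_mapping.rep_eq prod_fun_unfold_prod)
  also have "\<dots> = (\<Sum>x. Poly_Mapping.lookup p a * Poly_Mapping.lookup q b when x = (a, b))"
  proof (rule Sum_any.cong, clarify)
    fix a' b'
    show "(Poly_Mapping.lookup p a' * Poly_Mapping.lookup q b' when a + b = a' + b') =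
        (Poly_Mapping.lookup p a * Poly_Mapping.lookup q b when (a', b') = (a, b))"
    proof (cases "(a', b') = (a, b)")
      case False
      then have "a + b = a' + b' \<longrightarrow> Poly_Mapping.lookup p a' = 0 \<or> Poly_Mapping.lookup q b' = 0"
        using uniq[of a' b'] by (simp add: in_keys_iff) metis
      with False show ?thesis by (auto simp: when_def)
    qed simp
  qed
  also have "\<dots> = Poly_Mapping.lookup p a * Poly_Mapping.lookup q b"
    by simp
  finally have "Poly_Mapping.lookup (p * q) (a + b) \<noteq> 0"
    using ab by (simp add: in_keys_iff)
  then show ?thesis by auto
qed

instantiation zpoly :: (type) idom
begin

lift_definition zero_zpoly :: "'a zpoly" is 0 .
lift_definition one_zpoly :: "'a zpoly" is 1 .
lift_definition plus_zpoly :: "'a zpoly \<Rightarrow> 'a zpoly \<Rightarrow> 'a zpoly" is "(+)" .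
lift_definition minus_zpoly :: "'a zpoly \<Rightarrow> 'a zpoly \<Rightarrow> 'a zpoly" is "(-)" .
lift_definition uminus_zpoly :: "'a zpoly \<Rightarrow> 'a zpoly" is "uminus" .
lift_definition times_zpoly :: "'a zpoly \<Rightarrow> 'a zpoly \<Rightarrow> 'a zpoly" is "(*)" .

instance
proof
  fix a b c :: "'a zpoly"
  show "a * b * c = a * (b * c)" by transfer (rule mult.assoc)
  show "a * b = b * a" by transfer (rule mult.commute)
  show "1 * a = a" by transfer simp
  show "a + b + c = a + (b + c)" by transfer (rule add.assoc)
  show "a + b = b + a" by transfer (rule add.commute)
  show "0 + a = a" by transfer simp
  show "0 * a = 0" "a * 0 = 0" by (transfer, simp)+
  show "- a + a = 0" by transfer simp
  show "a - b = a + - b" by transfer simp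
  show "(a + b) * c = a * c + b * c" by transfer (rule distrib_right)
  show "a * (b + c) = a * b + a * c" by transfer (rule distrib_left)
  show "(0::'a zpoly) \<noteq> 1" by transfer simp
  show "a \<noteq> 0 \<Longrightarrow> b \<noteq> 0 \<Longrightarrow> a * b \<noteq> 0" by transfer (rule poly_mapping_mult_nonzero)
qed

end


section \<open>Speyer's g-polynomial\<close>

text \<open>Elementary symmetric polynomial of the list \<open>(v a)\<^sub>a\<close>, \<open>a \<in> A\<close>.\<close>

definition esym :: "nat \<Rightarrow> 'a set \<Rightarrow> ('a \<Rightarrow> 'b::comm_ring_1) \<Rightarrow> 'b" where
  "esym k A v = (\<Sum>S | S \<subseteq> A \<and> card S = k. \<Prod>a\<in>S. v a)"

text \<open>Total orderings of \<open>E\<close> are the duplicate-free lists \<open>w\<close> with element set \<open>E\<close>. List positions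
  are counted from 0, so \<open>w ! k\<close> stands for \<open>w\<^bsub>k+1\<^esub>\<close>.\<close>

definition greedy_basis :: "('a set \<Rightarrow> bool) \<Rightarrow> 'a list \<Rightarrow> 'a set" where
  "greedy_basis indep w =
     {w ! k | k. k < length w \<and>
        matroid_rank indep (set (take (Suc k) w)) > matroid_rank indep (set (take k w))}"

definition deg :: "'a set \<Rightarrow> ('a list \<Rightarrow> 'a zpoly) \<Rightarrow> 'a zpoly fract" where
  "deg E f = (\<Sum>w\<in>permutations_of_set E.
     Fract (f w) (\<Prod>k<card E - 1. zvar (w ! k) - zvar (w ! Suc k)))"

text \<open>For the families occurring here, \<^const>\<open>deg\<close> takes values in the integers, so the g-polynomial
  is an integer polynomial. This is a theorem and not part of the definition, which
  produces a polynomial over the field of rational functions in the \<open>z\<^sub>e\<close>, a field containing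
  the integers.\<close>

definition g_coeff_sum :: "'a set \<Rightarrow> ('a set \<Rightarrow> bool) \<Rightarrow> nat \<Rightarrow> 'a zpoly fract" where
  "g_coeff_sum E indep i =
     (let n = card E; r = matroid_rank indep E in
      \<Sum>j<i. deg E (\<lambda>w.
        let B = greedy_basis indep w; \<alpha> = - zvar (last w); x = zvar; y = (\<lambda>c. - zvar c) in
          \<alpha> ^ j * esym (i - j - 1) (E - B) (\<lambda>c. - y c) * esym (r - i) B x * esym (n - r) (E - B) y))"

definition g_poly :: "'a set \<Rightarrow> ('a set \<Rightarrow> bool) \<Rightarrow> 'a zpoly fract poly" where
  "g_poly E indep =
     (if E = {} then 1
      else if \<exists>e. is_loop E indep e \<or> is_coloop E indep e then 0
      else (-1) ^ card (components E indep) *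
        (\<Sum>i=1..matroid_rank indep E. smult (g_coeff_sum E indep i) ((- [:0, 1:]) ^ i)))"

definition omega :: "'a set \<Rightarrow> ('a set \<Rightarrow> bool) \<Rightarrow> 'a zpoly fract" where
  "omega E indep = coeff (g_poly E indep) (matroid_rank indep E)"

end

theory Submission
  imports Defs
begin

text \<open>
  Since \<open>n = 2r\<close> and there are no coloops, the sum over \<open>j\<close> in the coefficient of \<open>t\<^sup>r\<close> telescopes, and
  \<open>\<omega>\<close> becomes, up to the sign \<open>(-1)\<^sup>c\<close>, the sum over the orderings \<open>w\<close> of
  \<open>z\<^bsub>last w\<^esub> \<Prod> z\<^sub>c\<^sup>2 / \<Prod> (z\<^bsub>w i\<^esub> - z\<^bsub>w (i + 1)\<^esub>)\<close>, with \<open>c\<close> ranging over \<open>E - B\<^sub>w - {last w}\<close>. This is a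
  Brion formula for the interior lattice points of twice the base polytope of the dual matroid,
  shifted by \<open>-(1, ..., 1)\<close>; the only candidate is the origin.

  Expand each summand as a formal Laurent series, with directions prescribed by a fixed
  ordering \<open>idx\<close> of \<open>E\<close>. With \<open>h p S = |S| - 2 rank S - p S\<close>, the coefficient of \<open>z\<^sup>p\<close> in the
  total is a signed count of permutations which turns out to be, up to sign, the Moebius function
  from \<open>{}\<close> to \<open>E\<close> of the poset of all \<open>S\<close> with \<open>h p S \<ge> 0\<close>. As \<open>h p\<close> is supermodular, the join
  with a minimal nonempty maximiser of \<open>h p\<close> makes this vanish unless \<open>h p \<le> 0\<close> and the zeros
  of \<open>h p\<close> are closed under complements. The latter never happens for \<open>p \<noteq> 0\<close>; for \<open>p = 0\<close> it says
  that the crowded sets are exactly the unions of components, where the poset is Boolean.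
\<close>

section \<open>Rank, direct sums and components\<close>

context matroid
begin

abbreviation rk :: "'a set \<Rightarrow> nat" where "rk \<equiv> matroid_rank indep"

lemma indep_finite: "indep X \<Longrightarrow> finite X"
  using indep_subset_ground finite_ground finite_subset by blast

lemma finite_indep_cards: "finite {card X | X. X \<subseteq> S \<and> indep X}"
  by (rule finite_subset[of _ "card ` Pow E"]) (use indep_subset_ground finite_ground in auto)

lemma indep_card_le_rank: "indep X \<Longrightarrow> X \<subseteq> S \<Longrightarrow> card X \<le> rk S"
  unfolding matroid_rank_def by (rule Max_ge[OF finite_indep_cards]) auto

lemma rank_witness:
  obtains X where "X \<subseteq> S" "indep X" "card X = rk S"
proof -
  have "rk S \<in> {card X | X. X \<subseteq> S \<and> indep X}"
    unfolding matroid_rank_def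
    by (rule Max_in[OF finite_indep_cards]) (use indep_empty in auto)
  then show ?thesis using that by auto
qed

lemma rank_indep: "indep X \<Longrightarrow> rk X = card X"
  by (metis indep_card_le_rank indep_finite card_mono le_antisym order_refl rank_witness)

lemma indep_iff_rank: "X \<subseteq> E \<Longrightarrow> indep X \<longleftrightarrow> rk X = card X"
  by (metis finite_ground finite_subset rank_indep rank_witness card_subset_eq)

lemma rank_empty [simp]: "rk {} = 0"
  using rank_indep[OF indep_empty] by simp

lemma rank_mono: "S \<subseteq> T \<Longrightarrow> rk S \<le> rk T"
  by (metis indep_card_le_rank rank_witness order_trans)

lemma rank_le_card: "finite S \<Longrightarrow> rk S \<le> card S"
  by (metis card_mono rank_witness)

lemma extend_indep:
  assumes "indep X" "X \<subseteq> S"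
  obtains Y where "X \<subseteq> Y" "Y \<subseteq> S" "indep Y" "card Y = rk S"
proof -
  have "\<exists>Y. X \<subseteq> Y \<and> Y \<subseteq> S \<and> indep Y \<and> card Y = rk S"
    using assms
  proof (induction "rk S - card X" arbitrary: X)
    case 0
    then have "card X = rk S" using indep_card_le_rank[of X S] by simp
    with 0 show ?case by blast
  next
    case (Suc k)
    obtain Z where Z: "Z \<subseteq> S" "indep Z" "card Z = rk S" by (rule rank_witness)
    with Suc.hyps(2) have "card X < card Z" by simp
    from indep_augment[OF Suc.prems(1) Z(2) this] obtain e
      where e: "e \<in> Z - X" "indep (insert e X)" by blast
    have "card (insert e X) = Suc (card X)"
      using e(1) indep_finite[OF Suc.prems(1)] by simp
    with Suc.hyps(2) have "k = rk S - card (insert e X)" by simp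
    from Suc.hyps(1)[OF this e(2)] e(1) Z(1) Suc.prems(2) show ?case by blast
  qed
  then show ?thesis using that by blast
qed

lemma rank_submodular: "rk (S \<union> T) + rk (S \<inter> T) \<le> rk S + rk T"
proof -
  obtain X where X: "X \<subseteq> S \<inter> T" "indep X" "card X = rk (S \<inter> T)" by (rule rank_witness)
  obtain Y where Y: "X \<subseteq> Y" "Y \<subseteq> S \<union> T" "indep Y" "card Y = rk (S \<union> T)"
    using extend_indep[OF X(2), of "S \<union> T"] X(1) by blast
  note finY = indep_finite[OF Y(3)]
  have "card Y + card X \<le> card ((Y \<inter> S) \<union> (Y \<inter> T)) + card ((Y \<inter> S) \<inter> (Y \<inter> T))"
    using X(1) Y(1,2) finY by (intro add_mono card_mono) auto
  also have "\<dots> = card (Y \<inter> S) + card (Y \<inter> T)"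
    using finY by (simp add: card_Un_Int[symmetric])
  also have "\<dots> \<le> rk S + rk T"
    using Y(3) by (intro add_mono indep_card_le_rank indep_mono[OF Y(3)]) auto
  finally show ?thesis using X Y by simp
qed

lemma rank_insert_le: "rk (insert e S) \<le> Suc (rk S)"
proof -
  have "rk (insert e S) \<le> rk S + rk {e}"
    using rank_submodular[of S "{e}"] by simp
  also have "rk {e} \<le> 1" using rank_le_card[of "{e}"] by simp
  finally show ?thesis by simp
qed

section \<open>Restrictions, direct sums and connected components\<close>

lemma rank_restriction: "S \<subseteq> T \<Longrightarrow> matroid_rank (restriction indep T) S = rk S"
  unfolding matroid_rank_def restriction_def
  by (rule arg_cong[where f = Max]) auto

lemma matroid_restriction:
  assumes T: "T \<subseteq> E"
  shows "matroid T (restriction indep T)"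
proof
  show "finite T" using T finite_ground finite_subset by blast
  fix X Y
  assume X: "restriction indep T X" and Y: "restriction indep T Y" and less: "card X < card Y"
  then obtain e where "e \<in> Y - X" "indep (insert e X)"
    using indep_augment[of X Y] by (auto simp: restriction_def)
  then show "\<exists>e\<in>Y - X. restriction indep T (insert e X)"
    using X Y by (auto simp: restriction_def)
qed (auto simp: restriction_def indep_empty intro: indep_mono)

text \<open>Submodularity for \<open>S\<close>, \<open>T\<close> and for
  \<open>S \<union> T\<close>, \<open>E - T\<close> add up to one inequality, because the terms
  \<open>rk (S \<union> T)\<close> cancel and the ranks of \<open>T\<close> and \<open>E - T\<close>
  add up to \<open>rk E\<close>. Subadditivity gives the other.\<close>

lemma rank_direct_sum:
  assumes "T \<subseteq> E" "rk T + rk (E - T) = rk E" "S \<subseteq> E"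
  shows "rk S = rk (S \<inter> T) + rk (S - T)"
proof -
  have "rk (S \<union> T) + rk (S \<inter> T) \<le> rk S + rk T"
    by (rule rank_submodular)
  moreover have "rk ((S \<union> T) \<union> (E - T)) + rk ((S \<union> T) \<inter> (E - T)) \<le> rk (S \<union> T) + rk (E - T)"
    by (rule rank_submodular)
  moreover have "(S \<union> T) \<union> (E - T) = E" "(S \<union> T) \<inter> (E - T) = S - T"
    using assms by auto
  moreover have "rk ((S \<inter> T) \<union> (S - T)) + rk ((S \<inter> T) \<inter> (S - T)) \<le> rk (S \<inter> T) + rk (S - T)"
    by (rule rank_submodular)
  moreover have "(S \<inter> T) \<union> (S - T) = S" by auto
  ultimately show ?thesis using assms(2) by simp
qed

text \<open>Maximal independent subsets of \<open>T\<close> and \<open>E - T\<close> have an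
  independent union, which bounds the rank sum by \<open>rk E\<close>; submodularity is the reverse
  bound. Conversely, additivity of the rank makes a set full in rank once its two parts are.\<close>

lemma direct_summand_iff_rank:
  "direct_summand E indep T \<longleftrightarrow> T \<subseteq> E \<and> rk T + rk (E - T) = rk E"
proof
  assume T: "direct_summand E indep T"
  then have sub: "T \<subseteq> E" by (simp add: direct_summand_def)
  obtain X where X: "X \<subseteq> T" "indep X" "card X = rk T" by (rule rank_witness)
  obtain Y where Y: "Y \<subseteq> E - T" "indep Y" "card Y = rk (E - T)" by (rule rank_witness)
  have "(X \<union> Y) \<inter> T = X" "(X \<union> Y) - T = Y" "X \<union> Y \<subseteq> E" using X Y sub by auto
  with T X Y have "indep (X \<union> Y)"
    unfolding direct_summand_def restriction_def by metis
  then have "card (X \<union> Y) \<le> rk E"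
    using \<open>X \<union> Y \<subseteq> E\<close> by (rule indep_card_le_rank)
  moreover have "card (X \<union> Y) = card X + card Y"
    by (rule card_Un_disjoint) (use X Y indep_finite in auto)
  moreover have "rk (T \<union> (E - T)) + rk (T \<inter> (E - T)) \<le> rk T + rk (E - T)"
    by (rule rank_submodular)
  ultimately show "T \<subseteq> E \<and> rk T + rk (E - T) = rk E"
    using X Y sub by (simp add: Un_absorb1)
next
  assume T: "T \<subseteq> E \<and> rk T + rk (E - T) = rk E"
  have "indep X \<longleftrightarrow> indep (X \<inter> T) \<and> indep (X - T)" if X: "X \<subseteq> E" for X
  proof
    assume "indep X"
    then show "indep (X \<inter> T) \<and> indep (X - T)" using indep_mono by blast
  next
    assume ind: "indep (X \<inter> T) \<and> indep (X - T)"
    have "rk X = card (X \<inter> T) + card (X - T)"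
      using rank_direct_sum[of T X] T X ind by (simp add: rank_indep)
    also have "\<dots> = card ((X \<inter> T) \<union> (X - T))"
      by (rule card_Un_disjoint[symmetric]) (use ind indep_finite in auto)
    also have "(X \<inter> T) \<union> (X - T) = X" by auto
    finally show "indep X" using X by (simp add: indep_iff_rank)
  qed
  then show "direct_summand E indep T"
    using T unfolding direct_summand_def restriction_def by auto
qed

lemma direct_summand_restriction_iff_rank:
  assumes "C \<subseteq> E"
  shows "direct_summand C (restriction indep C) T \<longleftrightarrow> T \<subseteq> C \<and> rk T + rk (C - T) = rk C"
  using matroid.direct_summand_iff_rank[OF matroid_restriction[OF assms], of T] assms
    rank_restriction[of T C] rank_restriction[of "C - T" C] rank_restriction[of C C] by auto

lemma components_altdef:
  "C \<in> components E indep \<longleftrightarrow> C \<noteq> {} \<and> C \<subseteq> E \<and> rk C + rk (E - C) = rk E \<and>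
     (\<forall>T. T \<subseteq> C \<longrightarrow> rk T + rk (C - T) = rk C \<longrightarrow> T = {} \<or> T = C)"
proof (cases "C \<subseteq> E")
  case True
  then show ?thesis
    unfolding components_def matroid_connected_def mem_Collect_eq direct_summand_iff_rank
      direct_summand_restriction_iff_rank[OF True] by metis
next
  case False
  then show ?thesis by (auto simp: components_def direct_summand_def)
qed

text \<open>The summand \<open>T\<close> of \<open>E\<close> cuts out the summand
  \<open>C \<inter> T\<close> of \<open>C\<close>, and \<open>C\<close> is connected.\<close>

lemma component_meets_summand:
  assumes C: "C \<in> components E indep" and T: "T \<subseteq> E" "rk T + rk (E - T) = rk E"
  shows "C \<inter> T = {} \<or> C \<subseteq> T"
proof -
  have "rk C = rk (C \<inter> T) + rk (C - T)"
    using rank_direct_sum[OF T, of C] C by (auto simp: components_altdef)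
  moreover have "C - C \<inter> T = C - T" by auto
  ultimately have "C \<inter> T = {} \<or> C \<inter> T = C"
    using C unfolding components_altdef by (metis Int_lower1)
  then show ?thesis by auto
qed

lemma components_disjoint:
  assumes "C \<in> components E indep" "D \<in> components E indep" "C \<noteq> D"
  shows "C \<inter> D = {}"
  using component_meets_summand[of C D] component_meets_summand[of D C] assms
  by (auto simp: components_altdef)

text \<open>A summand of least cardinality containing \<open>e\<close> is connected: a summand of it
  is also one of \<open>E\<close>, again by submodularity, and either it or its complement in
  \<open>C\<close> contains \<open>e\<close>.\<close>

lemma components_cover:
  assumes "e \<in> E"
  obtains C where "C \<in> components E indep" "e \<in> C"
proof -
  define P where "P = (\<lambda>C. e \<in> C \<and> C \<subseteq> E \<and> rk C + rk (E - C) = rk E)"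
  have "P E" using assms by (simp add: P_def)
  then obtain C where C: "P C" and min: "\<And>D. P D \<Longrightarrow> card C \<le> card D"
    using ex_has_least_nat[of P E card] by blast
  then have CE: "C \<subseteq> E" and eC: "e \<in> C" by (simp_all add: P_def)
  have finC: "finite C" using CE finite_ground finite_subset by blast
  have eq: "T = C" if T: "T \<subseteq> C" "rk T + rk (C - T) = rk C" "e \<in> T" for T
  proof -
    have "rk ((C - T) \<union> (E - C)) + rk ((C - T) \<inter> (E - C)) \<le> rk (C - T) + rk (E - C)"
      by (rule rank_submodular)
    moreover have "(C - T) \<union> (E - C) = E - T" using T CE by auto
    ultimately have "rk T + rk (E - T) \<le> rk E" using C T by (simp add: P_def)
    moreover have "rk (T \<union> (E - T)) + rk (T \<inter> (E - T)) \<le> rk T + rk (E - T)"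
      by (rule rank_submodular)
    moreover have "T \<union> (E - T) = E" using T CE by auto
    ultimately have "P T" using T CE by (simp add: P_def)
    from min[OF this] show "T = C" using T(1) finC by (simp add: card_seteq)
  qed
  have "T = {} \<or> T = C" if T: "T \<subseteq> C" "rk T + rk (C - T) = rk C" for T
  proof (cases "e \<in> T")
    case True
    with eq T show ?thesis by blast
  next
    case False
    have "C - (C - T) = T" using T by auto
    with eq[of "C - T"] T False eC show ?thesis by auto
  qed
  then have "C \<in> components E indep"
    using C by (auto simp: P_def components_altdef)
  then show ?thesis using that eC by blast
qed

lemma finite_components: "finite (components E indep)"
  by (rule finite_subset[of _ "Pow E"]) (auto simp: components_altdef finite_ground)

section \<open>Bases, loops, coloops and the greedy basis\<close>

lemma basis_card: "matroid_basis indep B \<longleftrightarrow> indep B \<and> card B = rk E"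
proof
  assume B: "matroid_basis indep B"
  then have ind: "indep B" by (simp add: matroid_basis_def)
  obtain Y where "B \<subseteq> Y" "indep Y" "card Y = rk E"
    by (rule extend_indep[OF ind indep_subset_ground[OF ind]])
  with B show "indep B \<and> card B = rk E" by (auto simp: matroid_basis_def)
next
  assume B: "indep B \<and> card B = rk E"
  have "X = B" if X: "indep X" "B \<subseteq> X" for X
  proof -
    have "card X \<le> card B"
      using indep_card_le_rank[OF X(1) indep_subset_ground[OF X(1)]] B by simp
    with X show ?thesis using card_seteq[OF indep_finite[OF X(1)]] by blast
  qed
  then show "matroid_basis indep B"
    using B by (simp add: matroid_basis_def)
qed

lemma loop_iff_rank: "e \<in> E \<Longrightarrow> is_loop E indep e \<longleftrightarrow> rk {e} = 0"
  using rank_le_card[of "{e}"] by (auto simp: is_loop_def indep_iff_rank)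

lemma coloop_iff_rank:
  assumes "e \<in> E"
  shows "is_coloop E indep e \<longleftrightarrow> rk (E - {e}) < rk E"
proof
  assume e: "is_coloop E indep e"
  obtain X where X: "X \<subseteq> E - {e}" "indep X" "card X = rk (E - {e})" by (rule rank_witness)
  with e have "rk (E - {e}) \<noteq> rk E" by (auto simp: is_coloop_def basis_card)
  moreover have "rk (E - {e}) \<le> rk E" by (rule rank_mono) auto
  ultimately show "rk (E - {e}) < rk E" by simp
next
  assume less: "rk (E - {e}) < rk E"
  have "e \<in> B" if "matroid_basis indep B" for B
  proof (rule ccontr)
    assume "e \<notin> B"
    with that have "B \<subseteq> E - {e}" "indep B" "card B = rk E"
      using indep_subset_ground by (auto simp: basis_card)
    with less indep_card_le_rank show False by (metis not_less)
  qed
  then show "is_coloop E indep e" using assms by (simp add: is_coloop_def)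
qed

lemma loop_or_coloop_component:
  assumes "is_loop E indep e \<or> is_coloop E indep e"
  shows "{e} \<in> components E indep"
proof -
  have e: "e \<in> E" using assms by (auto simp: is_loop_def is_coloop_def)
  have "rk ({e} \<union> (E - {e})) + rk ({e} \<inter> (E - {e})) \<le> rk {e} + rk (E - {e})"
    by (rule rank_submodular)
  moreover have "{e} \<union> (E - {e}) = E" using e by auto
  ultimately have "rk E \<le> rk {e} + rk (E - {e})" by simp
  moreover have "rk (E - {e}) \<le> rk E" by (rule rank_mono) auto
  moreover have "rk {e} \<le> 1" using rank_le_card[of "{e}"] by simp
  ultimately have "rk {e} + rk (E - {e}) = rk E"
    using assms e by (auto simp: loop_iff_rank coloop_iff_rank)
  then show ?thesis using e by (auto simp: components_altdef)
qed

text \<open>Each new entry raises the rank by at most one, and it is put into the greedy basis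
  exactly when the rank rises.\<close>

lemma card_greedy_basis_prefix:
  assumes "distinct w" "k \<le> length w"
  shows "card (set (take k w) \<inter> greedy_basis indep w) = rk (set (take k w))"
  using assms(2)
proof (induction k)
  case 0
  then show ?case by simp
next
  case (Suc k)
  then have k: "k < length w" by simp
  have new: "w ! k \<notin> set (take k w)"
    using assms(1) k by (auto simp: in_set_conv_nth nth_eq_iff_index_eq)
  have ins: "set (take (Suc k) w) = insert (w ! k) (set (take k w))"
    using k by (simp add: take_Suc_conv_app_nth)
  have mem: "w ! k \<in> greedy_basis indep w \<longleftrightarrow> rk (set (take k w)) < rk (set (take (Suc k) w))"
    using assms(1) k by (auto simp: greedy_basis_def nth_eq_iff_index_eq)
  have le: "rk (set (take k w)) \<le> rk (set (take (Suc k) w))"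
    by (rule rank_mono) (auto simp: ins)
  have "rk (set (take (Suc k) w)) \<le> Suc (rk (set (take k w)))"
    unfolding ins by (rule rank_insert_le)
  then show ?case
    using Suc new mem le by (auto simp: ins Int_insert_left)
qed

lemma greedy_basis_subset: "greedy_basis indep w \<subseteq> set w"
  by (auto simp: greedy_basis_def)

end


section \<open>Signed permutation sums and the Moebius function\<close>

text \<open>Expanding the product marks every gap of \<open>w\<close> either as a descent of
  \<open>idx\<close> or as a cut after a prefix lying in \<open>A\<close>, with a sign -1 for each
  cut.\<close>

definition chain_weight :: "('a \<Rightarrow> nat) \<Rightarrow> 'a set set \<Rightarrow> 'a list \<Rightarrow> int" where
  "chain_weight idx A w =
     (\<Prod>k<length w - 1. of_bool (idx (w ! Suc k) < idx (w ! k)) - of_bool (set (take (Suc k) w) \<in> A))"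

text \<open>The value at \<open>{}\<close> is chosen such that \<open>-chain_char\<close> is the Moebius function \<open>T \<mapsto> \<mu>({}, T)\<close>
  of \<open>A \<union> {T}\<close> whenever \<open>{} \<in> A\<close>. In particular it does not depend on \<open>idx\<close>.\<close>

definition chain_char :: "('a \<Rightarrow> nat) \<Rightarrow> 'a set set \<Rightarrow> 'a set \<Rightarrow> int" where
  "chain_char idx A T =
     (if T = {} then -1 else \<Sum>w\<in>permutations_of_set T. chain_weight idx A w)"

lemma chain_weight_snoc:
  assumes "v \<noteq> []"
  shows "chain_weight idx A (v @ [a]) =
    chain_weight idx A v * (of_bool (idx a < idx (last v)) - of_bool (set v \<in> A))"
proof -
  obtain m where m: "length v = Suc m" using assms by (cases v) auto
  have last: "last v = v ! m" using assms m by (simp add: last_conv_nth)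
  have "chain_weight idx A (v @ [a]) =
    (\<Prod>k<Suc m. of_bool (idx ((v @ [a]) ! Suc k) < idx ((v @ [a]) ! k)) -
        of_bool (set (take (Suc k) (v @ [a])) \<in> A))"
    by (simp add: chain_weight_def m)
  also have "\<dots> = (\<Prod>k<m. of_bool (idx (v ! Suc k) < idx (v ! k)) - of_bool (set (take (Suc k) v) \<in> A)) *
      (of_bool (idx a < idx (last v)) - of_bool (set v \<in> A))"
    by (simp add: m nth_append last)
  finally show ?thesis by (simp add: chain_weight_def m)
qed

lemma sum_permutations_snoc:
  assumes "finite T" "T \<noteq> {}"
  shows "(\<Sum>w\<in>permutations_of_set T. f w) = (\<Sum>a\<in>T. \<Sum>v\<in>permutations_of_set (T - {a}). f (v @ [a]))"
proof -
  have "bij_betw (\<lambda>(a, v). v @ [a]) (SIGMA a:T. permutations_of_set (T - {a})) (permutations_of_set T)"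
  proof (rule bij_betw_imageI)
    show "inj_on (\<lambda>(a, v). v @ [a]) (SIGMA a:T. permutations_of_set (T - {a}))"
      by (rule inj_onI) clarsimp
    show "(\<lambda>(a, v). v @ [a]) ` (SIGMA a:T. permutations_of_set (T - {a})) = permutations_of_set T"
    proof (intro equalityI subsetI)
      fix w assume "w \<in> (\<lambda>(a, v). v @ [a]) ` (SIGMA a:T. permutations_of_set (T - {a}))"
      then obtain a v where "w = v @ [a]" "a \<in> T" "v \<in> permutations_of_set (T - {a})"
        by clarsimp
      then show "w \<in> permutations_of_set T"
        by (intro permutations_of_setI) (auto dest: permutations_of_setD)
    next
      fix w assume w: "w \<in> permutations_of_set T"
      then have "w \<noteq> []" using assms(2) by (auto dest: permutations_of_setD)
      then obtain v a where va: "w = v @ [a]" by (meson rev_exhaust)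
      have dw: "set w = T" "distinct w" using permutations_of_setD[OF w] by simp_all
      have "v \<in> permutations_of_set (T - {a})"
        by (rule permutations_of_setI) (use va dw in auto)
      moreover have "a \<in> T" using va dw by auto
      ultimately show "w \<in> (\<lambda>(a, v). v @ [a]) ` (SIGMA a:T. permutations_of_set (T - {a}))"
        using va by (intro image_eqI[of _ _ "(a, v)"]) auto
    qed
  qed
  then have "(\<Sum>w\<in>permutations_of_set T. f w) =
      (\<Sum>x\<in>(SIGMA a:T. permutations_of_set (T - {a})). f (case x of (a, v) \<Rightarrow> v @ [a]))"
    by (rule sum.reindex_bij_betw[symmetric])
  also have "\<dots> = (\<Sum>a\<in>T. \<Sum>v\<in>permutations_of_set (T - {a}). f (v @ [a]))"
    using assms(1) by (subst sum.Sigma) (auto intro!: sum.cong)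
  finally show ?thesis .
qed

text \<open>Here \<open>S\<close> is the prefix at the last cut. The entries after it descend, so
  they list \<open>T - S\<close> in the only decreasing order, and the final entry \<open>a\<close>
  is the \<open>idx\<close>-minimum of \<open>T - S\<close>. The cut contributes the minus
  sign.\<close>

lemma chain_weight_ending_sum:
  assumes "finite T" "a \<in> T" "inj_on idx T" "{} \<in> A"
  shows "(\<Sum>v\<in>permutations_of_set (T - {a}). chain_weight idx A (v @ [a])) =
    - (\<Sum>S | S \<subseteq> T - {a} \<and> S \<in> A \<and> (\<forall>x\<in>T - S. idx a \<le> idx x). chain_char idx A S)"
  using assms
proof (induction "card T" arbitrary: T a rule: less_induct)
  case less
  define T' where "T' = T - {a}"
  have finT': "finite T'" using less.prems by (simp add: T'_def)
  show ?case
  proof (cases "T' = {}")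
    case True
    then have "T = {a}" using less.prems(2) by (auto simp: T'_def)
    \<comment> \<open>Only \<open>S = {}\<close> occurs, which stands for no cut at all; the default
      value -1 of \<open>chain_char\<close> at the empty set gives this term the weight 1.\<close>
    moreover have "{S. S = {} \<and> S \<in> A \<and> (\<forall>x\<in>{a} - S. idx a \<le> idx x)} = {{}}"
      using less.prems(4) by auto
    ultimately show ?thesis by (simp add: chain_weight_def chain_char_def)
  next
    case False
    define F where "F = (\<lambda>b. \<Sum>u\<in>permutations_of_set (T' - {b}). chain_weight idx A (u @ [b]))"
    define Q where "Q = (\<lambda>b. {S. S \<subseteq> T' - {b} \<and> S \<in> A \<and> (\<forall>x\<in>T' - S. idx b \<le> idx x)})"
    have IH: "F b = - (\<Sum>S\<in>Q b. chain_char idx A S)" if "b \<in> T'" for b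
      unfolding F_def Q_def
    proof (rule less.hyps)
      show "card T' < card T"
        unfolding T'_def using less.prems by (intro card_Diff1_less) auto
      show "inj_on idx T'" using less.prems(3) by (auto simp: T'_def intro: inj_on_subset)
    qed (use that finT' less.prems in auto)
    have finQ: "finite (Q b)" for b
      by (rule finite_subset[of _ "Pow T'"]) (use finT' in \<open>auto simp: Q_def\<close>)
    \<comment> \<open>The last factor is split: its descent part restricts the preceding entry
      \<open>b\<close> and is evaluated by induction, its cut part yields the single set
      \<open>T'\<close>.\<close>
    have "(\<Sum>v\<in>permutations_of_set T'. chain_weight idx A (v @ [a])) =
      (\<Sum>v\<in>permutations_of_set T'. of_bool (idx a < idx (last v)) * chain_weight idx A v) -
        of_bool (T' \<in> A) * chain_char idx A T'"
    proof -
      have "chain_weight idx A (v @ [a]) =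
          of_bool (idx a < idx (last v)) * chain_weight idx A v - of_bool (T' \<in> A) * chain_weight idx A v"
        if v: "v \<in> permutations_of_set T'" for v
      proof -
        have "v \<noteq> []" "set v = T'" using False permutations_of_setD[OF v] by auto
        then show ?thesis by (simp add: chain_weight_snoc algebra_simps)
      qed
      then show ?thesis
        using False by (simp add: chain_char_def sum_subtractf sum_distrib_left)
    qed
    also have "(\<Sum>v\<in>permutations_of_set T'. of_bool (idx a < idx (last v)) * chain_weight idx A v) =
      (\<Sum>b\<in>T'. of_bool (idx a < idx b) * F b)"
      by (simp only: sum_permutations_snoc[OF finT' False] F_def sum_distrib_left last_snoc)
    also have "\<dots> = (\<Sum>b | b \<in> T' \<and> idx a < idx b. F b)"
      using finT' by (simp add: sum.inter_filter of_bool_def if_distrib if_distribR cong: if_cong)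
    also have "\<dots> = - (\<Sum>b | b \<in> T' \<and> idx a < idx b. \<Sum>S\<in>Q b. chain_char idx A S)"
      by (simp add: IH sum_negf)
    also have "(\<Sum>b | b \<in> T' \<and> idx a < idx b. \<Sum>S\<in>Q b. chain_char idx A S) =
      (\<Sum>S\<in>(\<Union>b\<in>{b \<in> T'. idx a < idx b}. Q b). chain_char idx A S)"
    proof (rule sum.UNION_disjoint[symmetric])
      have "b = c" if "b \<in> T'" "c \<in> T'" "S \<in> Q b" "S \<in> Q c" for b c S
      proof -
        have "idx b = idx c" using that by (auto simp: Q_def intro!: le_antisym)
        then show "b = c" using that less.prems(3) by (auto simp: T'_def inj_on_def)
      qed
      then show "\<forall>b\<in>{b \<in> T'. idx a < idx b}. \<forall>c\<in>{b \<in> T'. idx a < idx b}. b \<noteq> c \<longrightarrow> Q b \<inter> Q c = {}"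
        by blast
    qed (use finT' finQ in auto)
    \<comment> \<open>For a proper subset \<open>S\<close> of \<open>T'\<close>, the
      \<open>b\<close> is the \<open>idx\<close>-minimum of \<open>T' - S\<close>. Since
      \<open>a\<close> itself lies in \<open>T - S\<close>, minimality of \<open>a\<close> there
      amounts to \<open>idx a < idx b\<close>.\<close>
    also have "(\<Union>b\<in>{b \<in> T'. idx a < idx b}. Q b) =
      {S. S \<subset> T' \<and> S \<in> A \<and> (\<forall>x\<in>T - S. idx a \<le> idx x)}" (is "?L = ?R")
    proof (intro equalityI subsetI)
      fix S assume "S \<in> ?L"
      then obtain b where b: "b \<in> T'" "idx a < idx b" "S \<in> Q b" by blast
      have "idx a \<le> idx x" if "x \<in> T - S" for x
      proof (cases "x = a")
        case False
        then have "idx b \<le> idx x" using that b by (auto simp: Q_def T'_def)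
        with b show ?thesis by simp
      qed simp
      with b show "S \<in> ?R" by (auto simp: Q_def)
    next
      fix S assume S: "S \<in> ?R"
      then obtain b where b: "b \<in> T' - S" and min: "\<And>c. c \<in> T' - S \<Longrightarrow> idx b \<le> idx c"
        using ex_has_least_nat[of "\<lambda>c. c \<in> T' - S" _ idx] by blast
      have "idx a \<le> idx b" "idx a \<noteq> idx b"
        using S b less.prems(2,3) by (auto simp: T'_def inj_on_def)
      then have "idx a < idx b" by simp
      moreover have "S \<in> Q b" using S b min by (auto simp: Q_def)
      ultimately show "S \<in> ?L" using b by auto
    qed
    also have "- (\<Sum>S | S \<subset> T' \<and> S \<in> A \<and> (\<forall>x\<in>T - S. idx a \<le> idx x). chain_char idx A S) -
        of_bool (T' \<in> A) * chain_char idx A T' =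
      - (\<Sum>S | S \<subseteq> T' \<and> S \<in> A \<and> (\<forall>x\<in>T - S. idx a \<le> idx x). chain_char idx A S)"
    proof (cases "T' \<in> A")
      case True
      have "{S. S \<subseteq> T' \<and> S \<in> A \<and> (\<forall>x\<in>T - S. idx a \<le> idx x)} =
        insert T' {S. S \<subset> T' \<and> S \<in> A \<and> (\<forall>x\<in>T - S. idx a \<le> idx x)}"
        using True less.prems(2) by (auto simp: T'_def)
      moreover have "finite {S. S \<subset> T' \<and> S \<in> A \<and> (\<forall>x\<in>T - S. idx a \<le> idx x)}"
        by (rule finite_subset[of _ "Pow T'"]) (use finT' in auto)
      ultimately show ?thesis using True by simp
    next
      case False
      then have "{S. S \<subset> T' \<and> S \<in> A \<and> (\<forall>x\<in>T - S. idx a \<le> idx x)} =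
        {S. S \<subseteq> T' \<and> S \<in> A \<and> (\<forall>x\<in>T - S. idx a \<le> idx x)}"
        by blast
      with False show ?thesis by simp
    qed
    finally show ?thesis by (simp add: T'_def)
  qed
qed

text \<open>Every proper subset \<open>S\<close> has exactly one \<open>idx\<close>-minimal element
  \<open>a\<close> in its complement, so summing over the final entry \<open>a\<close> counts every
  \<open>S\<close> once. This is the defining recursion of the Moebius function, up to the global
  sign.\<close>

lemma chain_char_recursion:
  assumes "finite T" "T \<noteq> {}" "inj_on idx T" "{} \<in> A"
  shows "chain_char idx A T = - (\<Sum>S | S \<subset> T \<and> S \<in> A. chain_char idx A S)"
proof -
  define Q where "Q = (\<lambda>a. {S. S \<subseteq> T - {a} \<and> S \<in> A \<and> (\<forall>x\<in>T - S. idx a \<le> idx x)})"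
  have finQ: "finite (Q b)" for b
    by (rule finite_subset[of _ "Pow T"]) (use assms in \<open>auto simp: Q_def\<close>)
  have "chain_char idx A T = (\<Sum>a\<in>T. \<Sum>v\<in>permutations_of_set (T - {a}). chain_weight idx A (v @ [a]))"
    using assms by (simp add: chain_char_def sum_permutations_snoc)
  also have "\<dots> = - (\<Sum>a\<in>T. \<Sum>S\<in>Q a. chain_char idx A S)"
    using assms by (simp add: chain_weight_ending_sum Q_def sum_negf)
  also have "(\<Sum>a\<in>T. \<Sum>S\<in>Q a. chain_char idx A S) = (\<Sum>S\<in>(\<Union>a\<in>T. Q a). chain_char idx A S)"
  proof (rule sum.UNION_disjoint[symmetric])
    have "b = c" if "b \<in> T" "c \<in> T" "S \<in> Q b" "S \<in> Q c" for b c S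
    proof -
      have "idx b = idx c" using that by (auto simp: Q_def intro!: le_antisym)
      then show "b = c" using that assms(3) by (auto simp: inj_on_def)
    qed
    then show "\<forall>b\<in>T. \<forall>c\<in>T. b \<noteq> c \<longrightarrow> Q b \<inter> Q c = {}" by blast
  qed (use finQ assms in auto)
  also have "(\<Union>a\<in>T. Q a) = {S. S \<subset> T \<and> S \<in> A}" (is "?L = ?R")
  proof (intro equalityI subsetI)
    fix S assume S: "S \<in> ?R"
    then obtain a where a: "a \<in> T - S" "\<And>c. c \<in> T - S \<Longrightarrow> idx a \<le> idx c"
      using ex_has_least_nat[of "\<lambda>c. c \<in> T - S" _ idx] by blast
    then have "S \<in> Q a" using S by (auto simp: Q_def)
    with a show "S \<in> ?L" by blast
  qed (auto simp: Q_def)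
  finally show ?thesis .
qed

section \<open>Vanishing and evaluation of the Moebius function\<close>

lemma chain_char_sum_eq_0:
  assumes "finite T" "T \<noteq> {}" "inj_on idx T" "{} \<in> A" "T \<in> A"
  shows "(\<Sum>S | S \<subseteq> T \<and> S \<in> A. chain_char idx A S) = 0"
proof -
  have "{S. S \<subseteq> T \<and> S \<in> A} = insert T {S. S \<subset> T \<and> S \<in> A}" using assms by auto
  moreover have "finite {S. S \<subset> T \<and> S \<in> A}"
    by (rule finite_subset[of _ "Pow T"]) (use assms in auto)
  ultimately show ?thesis using chain_char_recursion[OF assms(1-4)] by simp
qed

text \<open>Weisner's theorem: for every \<open>V\<close> above \<open>R\<close>, the values at all \<open>S\<close> with \<open>S \<union> R = V\<close> add up to 0.\<close>

lemma chain_char_eq_0: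
  assumes E: "finite E" "inj_on idx E" and A: "A \<subseteq> Pow E" "{} \<in> A" "E \<in> A"
    and R: "R \<in> A" "R \<noteq> {}" "R \<noteq> E" and closed: "\<And>S. S \<in> A \<Longrightarrow> S \<union> R \<in> A"
    and no_compl: "\<And>S. S \<in> A \<Longrightarrow> S \<union> R = E \<Longrightarrow> S = E"
  shows "chain_char idx A E = 0"
proof -
  have finA: "finite A" using A(1) E(1) finite_subset by blast
  have W: "(\<Sum>S | S \<in> A \<and> S \<union> R = V. chain_char idx A S) = 0" if "V \<in> A" "R \<subseteq> V" for V
    using that
  proof (induction "card V" arbitrary: V rule: less_induct)
    case (less V)
    have VE: "V \<subseteq> E" using less.prems A by blast
    then have finV: "finite V" using E(1) finite_subset by blast
    define \<V> where "\<V> = {U \<in> A. R \<subseteq> U \<and> U \<subseteq> V}"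
    have fin\<V>: "finite \<V>" using finA by (simp add: \<V>_def)
    have "0 = (\<Sum>S | S \<subseteq> V \<and> S \<in> A. chain_char idx A S)"
      using chain_char_sum_eq_0[of V idx A] finV less.prems R A inj_on_subset[OF E(2) VE] by auto
    \<comment> \<open>The sets below \<open>V\<close> are sorted by their join with
      \<open>R\<close>. All fibres over a smaller \<open>U\<close> vanish by induction, which leaves
      the fibre over \<open>V\<close>.\<close>
    also have "{S. S \<subseteq> V \<and> S \<in> A} = (\<Union>U\<in>\<V>. {S \<in> A. S \<union> R = U})"
      using less.prems closed by (auto simp: \<V>_def)
    also have "(\<Sum>S\<in>\<dots>. chain_char idx A S) = (\<Sum>U\<in>\<V>. \<Sum>S | S \<in> A \<and> S \<union> R = U. chain_char idx A S)"
      by (rule sum.UNION_disjoint) (use fin\<V> finA in auto)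
    also have "\<dots> = (\<Sum>U\<in>{V}. \<Sum>S | S \<in> A \<and> S \<union> R = U. chain_char idx A S)"
    proof (rule sum.mono_neutral_right)
      show "\<forall>U\<in>\<V> - {V}. (\<Sum>S | S \<in> A \<and> S \<union> R = U. chain_char idx A S) = 0"
        using less.hyps finV by (auto simp: \<V>_def intro!: psubset_card_mono)
    qed (use fin\<V> less.prems in \<open>auto simp: \<V>_def\<close>)
    finally show ?case by simp
  qed
  have "{S. S \<in> A \<and> S \<union> R = E} = {E}" using A R(1) no_compl by auto
  with W[of E] A R(1) show ?thesis by auto
qed

text \<open>A minimal nonempty maximiser \<open>R\<close> of \<open>h\<close> serves as the element
  in Weisner's theorem; that theorem would force the value 0 unless \<open>h R \<le> 0\<close> and
  \<open>h (E - R) \<ge> 0\<close>.\<close>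

lemma supermodular_chain_char_nonzero:
  fixes h :: "'a set \<Rightarrow> int"
  assumes E: "finite E" "inj_on idx E" and h: "h {} = 0" "h E = 0"
    and super: "\<And>S T. S \<subseteq> E \<Longrightarrow> T \<subseteq> E \<Longrightarrow> h S + h T \<le> h (S \<union> T) + h (S \<inter> T)"
    and nz: "chain_char idx {S. S \<subseteq> E \<and> h S \<ge> 0} E \<noteq> 0"
  shows "S \<subseteq> E \<Longrightarrow> h S \<le> 0" and "S \<subseteq> E \<Longrightarrow> h S = 0 \<Longrightarrow> h (E - S) = 0"
proof -
  have key: "h R \<le> 0 \<and> h (E - R) \<ge> 0"
    if R: "R \<subseteq> E" "R \<noteq> {}" "h R \<ge> 0" and max: "\<And>S. S \<subseteq> E \<Longrightarrow> h S \<le> h R"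
      and min: "\<And>S. S \<subset> R \<Longrightarrow> S \<noteq> {} \<Longrightarrow> h S < h R" for R
  proof (rule ccontr)
    assume neg: "\<not> (h R \<le> 0 \<and> h (E - R) \<ge> 0)"
    have "R \<noteq> E" using neg h by auto
    have closed: "h (S \<union> R) \<ge> 0" if "S \<subseteq> E" "h S \<ge> 0" for S
    proof -
      have "h (S \<inter> R) \<le> h R" by (rule max) (use R in auto)
      then show ?thesis using super[OF that(1) R(1)] that(2) by linarith
    qed
    \<comment> \<open>If \<open>S\<close> joins with \<open>R\<close> to \<open>E\<close>, then
      \<open>S \<inter> R\<close> is a maximiser as well, hence equal to \<open>R\<close> or empty
      by minimality. The empty case would make \<open>S\<close> the complement of \<open>R\<close>,
      which \<open>neg\<close> excludes.\<close>
    have no_compl: "S = E" if S: "S \<subseteq> E" "h S \<ge> 0" "S \<union> R = E" for S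
    proof -
      have ge: "h S + h R \<le> h (S \<inter> R)" using super[OF S(1) R(1)] S(3) h by simp
      have "S \<inter> R = R"
      proof (rule ccontr)
        assume ne: "S \<inter> R \<noteq> R"
        then have "S \<inter> R = {}" using min[of "S \<inter> R"] ge S(2) by fastforce
        then have "S = E - R" "h R \<le> 0" using S ge h by auto
        with neg S(2) show False by simp
      qed
      with S show ?thesis by auto
    qed
    have "chain_char idx {S. S \<subseteq> E \<and> h S \<ge> 0} E = 0"
      by (rule chain_char_eq_0[OF E, where R = R])
        (use R \<open>R \<noteq> E\<close> h closed no_compl in auto)
    with nz show False by simp
  qed
  show le: "h S \<le> 0" if "S \<subseteq> E" for S
  proof (rule ccontr)
    assume pos: "\<not> h S \<le> 0"
    define m where "m = Max (h ` Pow E)"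
    have finP: "finite (h ` Pow E)" using E by simp
    have hm: "h T \<le> m" if "T \<subseteq> E" for T
      unfolding m_def using that by (intro Max_ge finP) auto
    have "m \<in> h ` Pow E" unfolding m_def by (rule Max_in[OF finP]) auto
    then obtain R' where "R' \<subseteq> E \<and> h R' = m" by auto
    then obtain R where R: "R \<subseteq> E \<and> h R = m" and min: "\<And>T. T \<subseteq> E \<and> h T = m \<Longrightarrow> card R \<le> card T"
      using ex_has_least_nat[of "\<lambda>R. R \<subseteq> E \<and> h R = m" R' card] by blast
    have mpos: "m > 0" using hm[OF \<open>S \<subseteq> E\<close>] pos by simp
    have finR: "finite R" using R E finite_subset by blast
    have "h R \<le> 0 \<and> h (E - R) \<ge> 0"
    proof (rule key)
      fix T assume T: "T \<subset> R" "T \<noteq> {}"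
      then have "card T < card R" using finR by (simp add: psubset_card_mono)
      moreover have TE: "T \<subseteq> E" using T R by auto
      ultimately have "h T \<noteq> m" using min[of T] by auto
      with hm[OF TE] R show "h T < h R" by auto
    qed (use R mpos h hm in auto)
    with R mpos show False by simp
  qed
  show "h (E - S) = 0" if "S \<subseteq> E" "h S = 0" for S
    using that
  proof (induction "card S" arbitrary: S rule: less_induct)
    case (less S)
    show ?case
    proof (cases "S = {}")
      case True
      then show ?thesis using h by simp
    next
      case False
      have finS: "finite S" using less.prems E finite_subset by blast
      obtain R where R: "R \<subseteq> S \<and> R \<noteq> {} \<and> h R = 0"
        and min: "\<And>T. T \<subseteq> S \<and> T \<noteq> {} \<and> h T = 0 \<Longrightarrow> card R \<le> card T"
        using ex_has_least_nat[of "\<lambda>R. R \<subseteq> S \<and> R \<noteq> {} \<and> h R = 0" S card] False less.prems by auto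
      have finR: "finite R" using R finS finite_subset by blast
      have "h R \<le> 0 \<and> h (E - R) \<ge> 0"
      proof (rule key)
        fix T assume T: "T \<subset> R" "T \<noteq> {}"
        then have "card T < card R" using finR by (simp add: psubset_card_mono)
        with min[of T] have "h T \<noteq> 0" using T R by auto
        moreover have "T \<subseteq> E" using T R less.prems by auto
        ultimately show "h T < h R" using le[of T] R by auto
      qed (use R less.prems le in auto)
      then have R0: "h (E - R) = 0" using le[of "E - R"] by auto
      \<comment> \<open>Zeros are now maximisers of the supermodular \<open>h\<close>, so they are
        closed under intersection. This reduces the claim for \<open>S\<close> to those for
        \<open>R\<close> and for the smaller zero \<open>S - R\<close>.\<close>
      have inter: "h (U \<inter> V) = 0" if "U \<subseteq> E" "V \<subseteq> E" "h U = 0" "h V = 0" for U V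
        using super[OF that(1,2)] le[of "U \<union> V"] le[of "U \<inter> V"] that by force
      have "S - R = S \<inter> (E - R)" using less.prems by auto
      then have SR: "h (S - R) = 0" using inter[of S "E - R"] R0 less.prems by auto
      have "card (S - R) < card S"
        by (rule psubset_card_mono[OF finS]) (use R in auto)
      then have "h (E - (S - R)) = 0"
        using less.hyps[of "S - R"] SR less.prems by auto
      moreover have "E - S = (E - (S - R)) \<inter> (E - R)" using R by auto
      ultimately show ?thesis using inter[of "E - (S - R)" "E - R"] R0 by auto
    qed
  qed
qed

text \<open>The poset is the Boolean lattice on \<open>K\<close>.\<close>

lemma chain_char_unions:
  assumes K: "finite K" "\<And>C. C \<in> K \<Longrightarrow> C \<noteq> {} \<and> finite C"
      "\<And>C D. C \<in> K \<Longrightarrow> D \<in> K \<Longrightarrow> C \<noteq> D \<Longrightarrow> C \<inter> D = {}"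
    and idx: "inj_on idx (\<Union>K)" and J: "J \<subseteq> K"
  shows "chain_char idx {\<Union>J |J. J \<subseteq> K} (\<Union>J) = - ((-1) ^ card J)"
  using J
proof (induction "card J" arbitrary: J rule: less_induct)
  case (less J)
  let ?A = "{\<Union>J |J. J \<subseteq> K}"
  have finJ: "finite J" using less.prems K(1) finite_subset by blast
  show ?case
  proof (cases "J = {}")
    case True
    then show ?thesis by (simp add: chain_char_def)
  next
    case False
    \<comment> \<open>Members of \<open>K\<close> are nonempty and disjoint, so taking unions is an
      order embedding.\<close>
    have mono: "I \<subseteq> I'" if "I \<subseteq> K" "I' \<subseteq> K" "\<Union>I \<subseteq> \<Union>I'" for I I'
    proof
      fix C assume C: "C \<in> I"
      then have "C \<noteq> {}" using K(2) that(1) by blast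
      then obtain x where x: "x \<in> C" by blast
      then have "x \<in> \<Union>I'" using that(3) C by blast
      then obtain D where D: "D \<in> I'" "x \<in> D" by blast
      with x C have "C = D" using K(3)[of C D] that by blast
      with D show "C \<in> I'" by simp
    qed
    have inj: "inj_on \<Union> (Pow K)"
      by (rule inj_onI) (use mono in \<open>simp add: subset_antisym\<close>)
    have "{S. S \<subset> \<Union>J \<and> S \<in> ?A} = \<Union> ` (Pow J - {J})"
    proof (intro equalityI subsetI)
      fix S assume "S \<in> {S. S \<subset> \<Union>J \<and> S \<in> ?A}"
      then obtain I where I: "S = \<Union>I" "I \<subseteq> K" "\<Union>I \<subset> \<Union>J" by blast
      then have "I \<subseteq> J" "I \<noteq> J" using mono[of I J] less.prems by auto
      then show "S \<in> \<Union> ` (Pow J - {J})" using I by blast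
    next
      fix S assume "S \<in> \<Union> ` (Pow J - {J})"
      then obtain I where I: "S = \<Union>I" "I \<subseteq> J" "I \<noteq> J" by blast
      then have "\<Union>I \<noteq> \<Union>J" using mono[of J I] less.prems by blast
      then have "S \<subset> \<Union>J" using I by blast
      then show "S \<in> {S. S \<subset> \<Union>J \<and> S \<in> ?A}" using I less.prems by blast
    qed
    moreover have "chain_char idx ?A (\<Union>J) = - (\<Sum>S | S \<subset> \<Union>J \<and> S \<in> ?A. chain_char idx ?A S)"
    proof (rule chain_char_recursion)
      show "finite (\<Union>J)" using finJ less.prems K(2) by blast
      show "\<Union>J \<noteq> {}" using False less.prems K(2) by blast
      show "inj_on idx (\<Union>J)" using idx less.prems by (meson Union_mono inj_on_subset)
      show "{} \<in> ?A" by blast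
    qed
    ultimately have "chain_char idx ?A (\<Union>J) = - (\<Sum>S\<in>\<Union> ` (Pow J - {J}). chain_char idx ?A S)"
      by simp
    also have "\<dots> = - (\<Sum>I\<in>Pow J - {J}. chain_char idx ?A (\<Union>I))"
      by (subst sum.reindex) (use inj less.prems in \<open>auto intro: inj_on_subset\<close>)
    also have "\<dots> = - (\<Sum>I\<in>Pow J - {J}. - ((-1) ^ card I))"
    proof -
      have "chain_char idx ?A (\<Union>I) = - ((-1) ^ card I)" if "I \<in> Pow J - {J}" for I
        by (rule less.hyps) (use that less.prems finJ in \<open>auto intro!: psubset_card_mono\<close>)
      then show ?thesis by simp
    qed
    also have "\<dots> = (\<Sum>I\<in>Pow J. (-1) ^ card I) - (-1) ^ card J"
      using finJ by (simp add: sum_negf sum_diff1)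
    \<comment> \<open>The expansion of a product of factors -1 + 1 over the nonempty set
      \<open>J\<close>.\<close>
    also have "(\<Sum>I\<in>Pow J. (-1) ^ card I) = (0::int)"
      using prod_add[of J "\<lambda>_. -1::int" "\<lambda>_. 1"] finJ False by (simp add: power_0_left)
    finally show ?thesis by simp
  qed
qed


section \<open>Formal Laurent series with infinite support\<close>

text \<open>Functions \<open>('a \<Rightarrow> int) \<Rightarrow> int\<close> are regarded as Laurent series in the \<open>z\<^sub>a\<close> without any support
  condition. They cannot be multiplied with each other but form a module over the polynomials.\<close>

definition act :: "'a zpoly \<Rightarrow> (('a \<Rightarrow> int) \<Rightarrow> int) \<Rightarrow> ('a \<Rightarrow> int) \<Rightarrow> int" where
  "act q F p = (\<Sum>m\<in>Poly_Mapping.keys (rep_zpoly q).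
     Poly_Mapping.lookup (rep_zpoly q) m * F (\<lambda>a. p a - int (Poly_Mapping.lookup m a)))"

definition zmonom :: "('a \<Rightarrow>\<^sub>0 nat) \<Rightarrow> int \<Rightarrow> 'a zpoly" where
  "zmonom m c = abs_zpoly (Poly_Mapping.single m c)"

lemma rep_zmonom: "rep_zpoly (zmonom m c) = Poly_Mapping.single m c"
  by (simp add: zmonom_def abs_zpoly_inverse)

lemma zmonom_mult: "zmonom m c * zmonom m' c' = zmonom (m + m') (c * c')"
  by (metis rep_zmonom rep_zpoly_inject times_zpoly.rep_eq mult_single)

lemma act_superset:
  assumes "finite M" "Poly_Mapping.keys (rep_zpoly q) \<subseteq> M"
  shows "act q F p = (\<Sum>m\<in>M.
     Poly_Mapping.lookup (rep_zpoly q) m * F (\<lambda>a. p a - int (Poly_Mapping.lookup m a)))"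
  unfolding act_def
  by (rule sum.mono_neutral_left) (use assms in \<open>auto simp: in_keys_iff\<close>)

lemma act_add_left: "act (q + r) F p = act q F p + act r F p"
proof -
  let ?M = "Poly_Mapping.keys (rep_zpoly q) \<union> Poly_Mapping.keys (rep_zpoly r)"
  have "Poly_Mapping.keys (rep_zpoly (q + r)) \<subseteq> ?M"
    by (simp add: plus_zpoly.rep_eq keys_add)
  then have "act (q + r) F p = (\<Sum>m\<in>?M.
     Poly_Mapping.lookup (rep_zpoly (q + r)) m * F (\<lambda>a. p a - int (Poly_Mapping.lookup m a)))"
    by (intro act_superset) auto
  also have "\<dots> = act q F p + act r F p"
    by (simp add: act_superset[of ?M q] act_superset[of ?M r] plus_zpoly.rep_eq lookup_add
        distrib_right sum.distrib)
  finally show ?thesis .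
qed

lemma act_0_left [simp]: "act 0 F p = 0"
  by (simp add: act_def zero_zpoly.rep_eq)

lemma act_uminus_left: "act (- q) F p = - act q F p"
  using act_add_left[of q "- q" F p] by simp

lemma act_diff_left: "act (q - r) F p = act q F p - act r F p"
  using act_add_left[of q "- r" F p] by (simp add: act_uminus_left)

lemma act_sum_left: "act (\<Sum>i\<in>I. q i) F p = (\<Sum>i\<in>I. act (q i) F p)"
  by (induction I rule: infinite_finite_induct) (auto simp: act_add_left)

lemma act_sum_right: "act q (\<lambda>p. \<Sum>i\<in>I. F i p) p = (\<Sum>i\<in>I. act q (F i) p)"
  unfolding act_def sum_distrib_left by (rule sum.swap)

lemma act_zmonom: "act (zmonom m c) F p = c * F (\<lambda>a. p a - int (Poly_Mapping.lookup m a))"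
  by (cases "c = 0") (auto simp: act_def rep_zmonom)

lemma act_zvar: "act (zvar a) F p = F (p(a := p a - 1))"
proof -
  have "zvar a = zmonom (Poly_Mapping.single a 1) 1"
    by (simp add: zmonom_def zvar_def)
  moreover have "(\<lambda>b. p b - int (Poly_Mapping.lookup (Poly_Mapping.single a (1::nat)) b)) = p(a := p a - 1)"
    by (auto simp: lookup_single when_def)
  ultimately show ?thesis by (simp add: act_zmonom)
qed

text \<open>Statements that are additive in a polynomial reduce to monomials; this gives the module
  law \<open>act_mult\<close>.\<close>

lemma zpoly_induct [case_names zero add]:
  assumes zero: "P 0" and add: "\<And>m c q. P q \<Longrightarrow> P (zmonom m c + q)"
  shows "P q"
proof -
  have "P (abs_zpoly f)" for f
  proof (induction f rule: update_induct)
    case const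
    then show ?case using zero by (simp add: zero_zpoly_def)
  next
    case (update f a b)
    have "Poly_Mapping.update a b f = Poly_Mapping.single a b + f"
      using update(1) by (intro poly_mapping_eqI) (auto simp: lookup_update lookup_add lookup_single in_keys_iff)
    then have "abs_zpoly (Poly_Mapping.update a b f) = zmonom a b + abs_zpoly f"
      by (metis UNIV_I abs_zpoly_inverse plus_zpoly.rep_eq rep_zmonom rep_zpoly_inverse)
    then show ?case using add update by simp
  qed
  then show ?thesis by (metis rep_zpoly_inverse)
qed

lemma act_mult: "act (q * r) F p = act q (act r F) p"
proof (induction q arbitrary: p rule: zpoly_induct)
  case (add m c q)
  have "act (zmonom m c * r) F p = act (zmonom m c) (act r F) p"
  proof (induction r rule: zpoly_induct)
    case (add m' c' r)
    then show ?case
      by (simp add: distrib_left act_add_left zmonom_mult act_zmonom lookup_add algebra_simps)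
  qed (simp add: act_zmonom)
  with add show ?case by (simp add: distrib_right act_add_left)
qed simp

lemma act_1: "act 1 F = F"
proof -
  have one: "(1 :: 'a zpoly) = zmonom 0 1"
    by (simp add: zmonom_def one_zpoly_def)
  show ?thesis unfolding one by (simp add: act_zmonom fun_eq_iff)
qed

lemma act_of_int: "act (of_int c) F p = c * F p"
proof -
  have *: "act (of_nat n) F p = int n * F p" for n
    by (induction n) (auto simp: act_add_left act_1 algebra_simps)
  show ?thesis
    by (cases c rule: int_diff_cases) (simp add: act_diff_left * left_diff_distrib)
qed

definition delta :: "('a \<Rightarrow> int) \<Rightarrow> ('a \<Rightarrow> int) \<Rightarrow> int" where
  "delta u p = of_bool (p = u)"

text \<open>Acting on the point mass at 0 lists the coefficients of \<open>q\<close>. Hence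
  polynomial identities can be tested on this one series.\<close>

lemma act_delta_eq_0:
  assumes "act q (delta (\<lambda>_. 0)) = (\<lambda>_. 0)"
  shows "q = 0"
proof -
  have "Poly_Mapping.lookup (rep_zpoly q) m = 0" for m
  proof -
    have *: "(\<lambda>a. int (Poly_Mapping.lookup m a) - int (Poly_Mapping.lookup m' a)) = (\<lambda>_. 0) \<longleftrightarrow> m' = m"
      for m'
      by (auto simp: fun_eq_iff intro: poly_mapping_eqI)
    have "act q (delta (\<lambda>_. 0)) (\<lambda>a. int (Poly_Mapping.lookup m a)) =
      (\<Sum>m'\<in>Poly_Mapping.keys (rep_zpoly q). Poly_Mapping.lookup (rep_zpoly q) m' * of_bool (m' = m))"
      by (simp add: act_def delta_def *)
    also have "\<dots> = (\<Sum>m'\<in>Poly_Mapping.keys (rep_zpoly q). if m' = m then Poly_Mapping.lookup (rep_zpoly q) m' else 0)"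
      by (rule sum.cong) auto
    also have "\<dots> = Poly_Mapping.lookup (rep_zpoly q) m"
      by (simp add: in_keys_iff)
    finally show ?thesis using assms by simp
  qed
  then have "rep_zpoly q = 0" by (intro poly_mapping_eqI) simp
  then show ?thesis by (metis rep_zpoly_inject zero_zpoly.rep_eq)
qed

lemma act_zvar_delta: "act (zvar a) (delta u) = delta (u(a := u a + 1))"
  by (auto simp: act_zvar delta_def fun_eq_iff)

lemma act_prod_zvar_delta:
  assumes "finite A"
  shows "act (\<Prod>a\<in>A. zvar a) (delta u) = delta (\<lambda>a. u a + of_bool (a \<in> A))"
  using assms
proof (induction A)
  case (insert x A)
  have "act (\<Prod>a\<in>insert x A. zvar a) (delta u) = act (zvar x) (act (\<Prod>a\<in>A. zvar a) (delta u))"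
    using insert by (simp add: act_mult fun_eq_iff)
  also have "\<dots> = delta ((\<lambda>a. u a + of_bool (a \<in> A))(x := u x + of_bool (x \<in> A) + 1))"
    by (simp add: insert act_zvar_delta)
  also have "(\<lambda>a. u a + of_bool (a \<in> A))(x := u x + of_bool (x \<in> A) + 1) =
      (\<lambda>a. u a + of_bool (a \<in> insert x A))"
    using insert by (auto simp: fun_eq_iff)
  finally show ?case .
qed (simp add: act_1)

lemma zvar_inject [simp]: "zvar a = zvar b \<longleftrightarrow> a = b"
proof
  assume "zvar a = zvar b"
  then have "delta ((\<lambda>_. 0)(a := 1)) ((\<lambda>_. 0)(a := 1)) = delta ((\<lambda>_. 0)(b := 1)) ((\<lambda>_. 0)(a := 1))"
    using act_zvar_delta[of a "\<lambda>_. 0"] act_zvar_delta[of b "\<lambda>_. 0"] by simp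
  then have "(\<lambda>_. 0)(a := 1) = ((\<lambda>_. 0)(b := 1 :: int))"
    by (simp add: delta_def split: if_splits)
  from fun_cong[OF this, of a] show "a = b" by (simp split: if_splits)
qed simp

section \<open>From Laurent expansions back to fractions\<close>

lemma sum_Fract:
  assumes "finite W"
  shows "(\<Sum>w\<in>W. Fract (f w) d) = Fract (\<Sum>w\<in>W. f w) (d :: 'b::idom)"
proof (cases "d = 0")
  case True
  then show ?thesis by (simp add: eq_fract(2) fract_collapse)
next
  case False
  have "Fract a d + Fract b d = Fract (a + b) d" for a b
    using False by (simp add: eq_fract algebra_simps)
  with assms show ?thesis by (induction W) (auto simp: fract_collapse)
qed

text \<open>The premise on \<open>f\<close> says that \<open>s w\<close> is an expansion of
  \<open>f w / d w\<close>. Series cannot be divided, so the identity is multiplied by the common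
  denominator \<open>D\<close>, after which only polynomials act and \<open>act_delta_eq_0\<close>
  applies.\<close>

lemma sum_Fract_eq_of_int:
  fixes f d :: "'b \<Rightarrow> 'a zpoly"
  assumes W: "finite W" and d: "\<And>w. w \<in> W \<Longrightarrow> d w \<noteq> 0"
    and f: "\<And>w. w \<in> W \<Longrightarrow> act (f w) (delta (\<lambda>_. 0)) = act (d w) (s w)"
    and s: "\<And>p. (\<Sum>w\<in>W. s w p) = c * delta (\<lambda>_. 0) p"
  shows "(\<Sum>w\<in>W. Fract (f w) (d w)) = of_int c"
proof -
  define D where "D = (\<Prod>w\<in>W. d w)"
  define D' where "D' = (\<lambda>w. \<Prod>v\<in>W - {w}. d v)"
  have D: "D' w * d w = D" if "w \<in> W" for w
    unfolding D_def D'_def using prod.remove[OF W that, of d] by (simp add: mult.commute)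
  have D0: "D \<noteq> 0" unfolding D_def using W d by simp
  have "(\<Sum>w\<in>W. Fract (f w) (d w)) = (\<Sum>w\<in>W. Fract (D' w * f w) D)"
    by (rule sum.cong) (use d D0 D in \<open>auto simp: eq_fract algebra_simps\<close>)
  also have "\<dots> = Fract (\<Sum>w\<in>W. D' w * f w) D"
    using W by (rule sum_Fract)
  also have "(\<Sum>w\<in>W. D' w * f w) = of_int c * D"
  proof -
    have "act (\<Sum>w\<in>W. D' w * f w) (delta (\<lambda>_. 0)) p = act (of_int c * D) (delta (\<lambda>_. 0)) p" for p
    proof -
      have "act (\<Sum>w\<in>W. D' w * f w) (delta (\<lambda>_. 0)) p = (\<Sum>w\<in>W. act (D' w * d w) (s w) p)"
        by (simp add: act_sum_left act_mult f)
      also have "\<dots> = act D (\<lambda>p. \<Sum>w\<in>W. s w p) p"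
        by (simp add: D act_sum_right)
      also have "(\<lambda>p. \<Sum>w\<in>W. s w p) = act (of_int c) (delta (\<lambda>_. 0))"
        by (simp add: s act_of_int fun_eq_iff)
      also have "act D \<dots> p = act (of_int c * D) (delta (\<lambda>_. 0)) p"
        by (metis act_mult mult.commute)
      finally show ?thesis .
    qed
    then have "act ((\<Sum>w\<in>W. D' w * f w) - of_int c * D) (delta (\<lambda>_. 0)) = (\<lambda>_. 0)"
      by (simp add: act_diff_left fun_eq_iff)
    from act_delta_eq_0[OF this] show ?thesis by simp
  qed
  also have "Fract (of_int c * D) D = Fract (of_int c) 1"
    using D0 by (simp add: eq_fract)
  also have "Fract (of_int c) 1 = (of_int c :: 'a zpoly fract)"
  proof (cases c rule: int_diff_cases)
    case (diff m n)
    then show ?thesis by (simp add: of_nat_fract)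
  qed
  finally show ?thesis .
qed

text \<open>The series \<open>s\<close> expands \<open>z\<^sup>v / \<Prod> (z\<^bsub>w i\<^esub> - z\<^bsub>w (i + 1)\<^esub>)\<close>, with \<open>v\<close> the exponent on the right-hand
  side: \<open>c k p\<close> is the exponent of \<open>z\<^bsub>w (k + 1)\<^esub> / z\<^bsub>w k\<^esub>\<close>, and \<open>b k \<in> {0, 1}\<close> selects the direction of its
  geometric series, since \<open>of_bool (x \<ge> 0) - 1 = - of_bool (x < 0)\<close>. Each factor of the product
  takes the finite difference of one step function, which is a point mass.\<close>

lemma act_prod_differences:
  fixes w :: "'a list" and u :: "'a \<Rightarrow> int" and b :: "nat \<Rightarrow> int"
  assumes w: "distinct w" "set w = E" "w \<noteq> []"
  defines "n \<equiv> length w - 1"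
  defines "c \<equiv> (\<lambda>k p. \<Sum>a\<in>set (take (Suc k) w). u a - p a)"
  defines "s \<equiv> (\<lambda>p. if (\<forall>a. a \<notin> E \<longrightarrow> p a = 0) \<and> (\<Sum>a\<in>E. u a - p a) = 0
     then \<Prod>k<n. of_bool (c k p \<ge> 0) - b k else 0)"
  shows "act (\<Prod>k<n. zvar (w ! k) - zvar (w ! Suc k)) s =
    delta (\<lambda>a. if a \<in> E then u a + of_bool (a \<noteq> last w) else 0)"
proof -
  \<comment> \<open>The series left after the first \<open>m\<close> factors have acted: the step
    functions with index below \<open>m\<close> have become point conditions, and the later ones are
    translated by \<open>m\<close>, because both terms of each earlier factor shift them by
    one.\<close>
  define F where "F = (\<lambda>m p. if (\<forall>a. a \<notin> E \<longrightarrow> p a = 0) \<and> (\<Sum>a\<in>E. u a - p a) = - int m \<and>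
      (\<forall>k<m. c k p = - int (Suc k))
    then \<Prod>k\<in>{m..<n}. of_bool (c k p + int m \<ge> 0) - b k else 0)"
  have len: "length w = Suc n" using w(3) by (cases w) (auto simp: n_def)
  have nth_in: "w ! j \<in> set (take (Suc k) w) \<longleftrightarrow> j \<le> k" if "j \<le> n" "k \<le> n" for j k
  proof -
    have "set (take (Suc k) w) = nth w ` {0..<Suc k}"
      using that len by (simp add: nth_image)
    then show ?thesis using that w(1) len by (auto simp: nth_eq_iff_index_eq)
  qed
  have shift: "(\<Sum>a\<in>A. u a - (p(x := p x - 1)) a) = (\<Sum>a\<in>A. u a - p a) + of_bool (x \<in> A)"
    if "finite A" for A p x
  proof -
    have "(\<Sum>a\<in>A. u a - (p(x := p x - 1)) a) = (\<Sum>a\<in>A. (u a - p a) + (if a = x then 1 else 0))"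
      by (rule sum.cong) auto
    then show ?thesis using that by (simp add: sum.distrib)
  qed
  have finE: "finite E" using w(2) by auto
  have c_shift: "c k (p(w ! j := p (w ! j) - 1)) = c k p + of_bool (j \<le> k)" if "j \<le> n" "k \<le> n" for j k p
    unfolding c_def using that by (simp only: shift[OF finite_set] nth_in)
  have total_shift: "(\<Sum>a\<in>E. u a - (p(w ! j := p (w ! j) - 1)) a) = (\<Sum>a\<in>E. u a - p a) + 1"
    if "j \<le> n" for j p
  proof -
    have "w ! j \<in> E" using that len w(2) by auto
    then show ?thesis by (simp only: shift[OF finE] of_bool_eq)
  qed
  have supp_shift: "(\<forall>a. a \<notin> E \<longrightarrow> (p(w ! j := p (w ! j) - 1)) a = 0) \<longleftrightarrow> (\<forall>a. a \<notin> E \<longrightarrow> p a = 0)"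
    if "j \<le> n" for j p
  proof -
    have "w ! j \<in> E" using that len w(2) by auto
    then show ?thesis by (metis fun_upd_apply)
  qed
  have step: "act (zvar (w ! m) - zvar (w ! Suc m)) (F m) p = F (Suc m) p" if m: "m < n" for m p
  proof -
    have F1: "F m (p(w ! j := p (w ! j) - 1)) =
        (if (\<forall>a. a \<notin> E \<longrightarrow> p a = 0) \<and> (\<Sum>a\<in>E. u a - p a) = - int (Suc m) \<and> (\<forall>k<m. c k p = - int (Suc k))
         then (of_bool (c m p + of_bool (j = m) + int m \<ge> 0) - b m) *
           (\<Prod>k\<in>{Suc m..<n}. of_bool (c k p + int (Suc m) \<ge> 0) - b k) else 0)"
      if j: "j = m \<or> j = Suc m" for j
    proof -
      have jn: "j \<le> n" using j m by auto
      have c_eq: "c k (p(w ! j := p (w ! j) - 1)) = c k p + of_bool (j \<le> k)" if "k < n" for k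
        using c_shift[OF jn, of k p] that by simp
      have "c k (p(w ! j := p (w ! j) - 1)) = c k p" if "k < m" for k
        using c_eq[of k] that j m by auto
      then have "(\<forall>k<m. c k (p(w ! j := p (w ! j) - 1)) = - int (Suc k)) \<longleftrightarrow> (\<forall>k<m. c k p = - int (Suc k))"
        by (simp del: fun_upd_apply)
      moreover have "c k (p(w ! j := p (w ! j) - 1)) + int m = c k p + int (Suc m)"
        if "k \<in> {Suc m..<n}" for k
        using c_eq[of k] that j by auto
      then have "(\<Prod>k\<in>{Suc m..<n}. of_bool (c k (p(w ! j := p (w ! j) - 1)) + int m \<ge> 0) - b k) =
          (\<Prod>k\<in>{Suc m..<n}. of_bool (c k p + int (Suc m) \<ge> 0) - b k)"
        by (intro prod.cong) simp_all
      then have "(\<Prod>k\<in>{m..<n}. of_bool (c k (p(w ! j := p (w ! j) - 1)) + int m \<ge> 0) - b k) =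
          (of_bool (c m (p(w ! j := p (w ! j) - 1)) + int m \<ge> 0) - b m) *
           (\<Prod>k\<in>{Suc m..<n}. of_bool (c k p + int (Suc m) \<ge> 0) - b k)"
        by (simp only: prod.atLeast_Suc_lessThan[OF m])
      moreover have "c m (p(w ! j := p (w ! j) - 1)) = c m p + of_bool (j = m)"
        using c_eq[of m] j m by auto
      moreover have "(\<Sum>a\<in>E. u a - p a) + 1 = - int m \<longleftrightarrow> (\<Sum>a\<in>E. u a - p a) = - int (Suc m)"
        by auto
      ultimately show ?thesis
        unfolding F_def by (simp only: supp_shift[OF jn] total_shift[OF jn])
    qed
    have "act (zvar (w ! m) - zvar (w ! Suc m)) (F m) p =
        F m (p(w ! m := p (w ! m) - 1)) - F m (p(w ! Suc m := p (w ! Suc m) - 1))"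
      by (simp only: act_diff_left act_zvar)
    also have "\<dots> = F (Suc m) p"
    proof -
      define P where "P \<longleftrightarrow> (\<forall>a. a \<notin> E \<longrightarrow> p a = 0) \<and> (\<Sum>a\<in>E. u a - p a) = - int (Suc m) \<and>
          (\<forall>k<m. c k p = - int (Suc k))"
      define R where "R = (\<Prod>k\<in>{Suc m..<n}. of_bool (c k p + int (Suc m) \<ge> 0) - b k)"
      have "F m (p(w ! m := p (w ! m) - 1)) = (if P then (of_bool (c m p + 1 + int m \<ge> 0) - b m) * R else 0)"
        unfolding F1[OF disjI1[OF refl]] P_def R_def by (simp only: refl of_bool_eq)
      moreover have "F m (p(w ! Suc m := p (w ! Suc m) - 1)) = (if P then (of_bool (c m p + int m \<ge> 0) - b m) * R else 0)"
        unfolding F1[OF disjI2[OF refl]] P_def R_def by (simp only: n_not_Suc_n[symmetric] of_bool_eq add_0_right)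
      moreover have "F (Suc m) p = (if P \<and> c m p = - int (Suc m) then R else 0)"
        unfolding F_def P_def R_def by (rule if_cong) (auto simp only: less_Suc_eq)
      \<comment> \<open>Only the step function with index \<open>m\<close> sees the two terms of the
        factor differently. The direction \<open>b m\<close> cancels in the difference.\<close>
      moreover have "(of_bool (c m p + 1 + int m \<ge> 0) - b m) * R - (of_bool (c m p + int m \<ge> 0) - b m) * R =
          of_bool (c m p = - int (Suc m)) * R"
        by (cases "c m p + int m \<ge> 0"; cases "c m p = - int (Suc m)") (simp_all add: left_diff_distrib)
      ultimately show ?thesis by (simp add: algebra_simps)
    qed
    finally show ?thesis .
  qed
  have iter: "act (\<Prod>k<m. zvar (w ! k) - zvar (w ! Suc k)) s = F m" if "m \<le> n" for m
    using that
  proof (induction m)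
    case 0
    have "F 0 = s" unfolding F_def s_def by (simp add: lessThan_atLeast0 cong: if_cong)
    then show ?case by (simp add: act_1)
  next
    case (Suc m)
    have "act (\<Prod>k<Suc m. zvar (w ! k) - zvar (w ! Suc k)) s =
        act (zvar (w ! m) - zvar (w ! Suc m)) (act (\<Prod>k<m. zvar (w ! k) - zvar (w ! Suc k)) s)"
      by (simp add: act_mult[symmetric] fun_eq_iff mult.commute)
    also have "act (\<Prod>k<m. zvar (w ! k) - zvar (w ! Suc k)) s = F m"
      using Suc by simp
    also have "act (zvar (w ! m) - zvar (w ! Suc m)) (F m) = F (Suc m)"
      by (rule ext, rule step) (use Suc.prems in simp)
    finally show ?case .
  qed
  define v where "v = (\<lambda>a. if a \<in> E then u a + of_bool (a \<noteq> last w) else 0)"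
  have last: "last w = w ! n" using w(3) len by (simp add: last_conv_nth)
  have prefix: "(\<Sum>a\<in>set (take (Suc k) w). u a - p a) =
      (\<Sum>a\<in>set (take k w). u a - p a) + (u (w ! k) - p (w ! k))" if "k \<le> n" for k p
  proof -
    have "set (take (Suc k) w) = insert (w ! k) (set (take k w))"
      using that len by (simp add: take_Suc_conv_app_nth)
    moreover have "w ! k \<notin> set (take k w)"
      using that len w(1) by (auto simp: in_set_conv_nth nth_eq_iff_index_eq)
    ultimately show ?thesis by simp
  qed
  have total: "(\<Sum>a\<in>E. u a - p a) = (\<Sum>a\<in>set (take n w). u a - p a) + (u (w ! n) - p (w ! n))" for p
    using prefix[of n p] len w(2) by simp
  \<comment> \<open>Prescribing all partial sums along \<open>w\<close> fixes every exponent: they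
    fall by one per entry except at the last, where the total is already
    \<open>- int n\<close>.\<close>
  have iff: "(\<forall>a. a \<notin> E \<longrightarrow> p a = 0) \<and> (\<Sum>a\<in>E. u a - p a) = - int n \<and> (\<forall>k<n. c k p = - int (Suc k))
      \<longleftrightarrow> p = v" for p
  proof
    assume p: "(\<forall>a. a \<notin> E \<longrightarrow> p a = 0) \<and> (\<Sum>a\<in>E. u a - p a) = - int n \<and> (\<forall>k<n. c k p = - int (Suc k))"
    have pre: "(\<Sum>a\<in>set (take k w). u a - p a) = - int k" if "k \<le> n" for k
      using that p by (cases k) (auto simp: c_def)
    have "p (w ! k) = u (w ! k) + 1" if "k < n" for k
      using prefix[of k p] pre[of k] pre[of "Suc k"] that by simp
    moreover have "p (w ! n) = u (w ! n)"
      using total[of p] pre[of n] p by simp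
    ultimately have "p (w ! k) = v (w ! k)" if "k \<le> n" for k
      using that len w by (cases "k = n") (auto simp: v_def last nth_eq_iff_index_eq)
    then have "p a = v a" if "a \<in> E" for a
      using that w(2) len by (metis in_set_conv_nth less_Suc_eq_le)
    moreover have "p a = v a" if "a \<notin> E" for a
      using that p by (simp add: v_def)
    ultimately show "p = v" by blast
  next
    assume p: "p = v"
    have pre: "(\<Sum>a\<in>set (take k w). u a - p a) = - int k" if "k \<le> n" for k
      using that
    proof (induction k)
      case (Suc k)
      have "p (w ! k) = u (w ! k) + 1"
        using Suc.prems len w by (auto simp: p v_def last nth_eq_iff_index_eq)
      then show ?case using Suc prefix[of k p] by simp
    qed simp
    have "w ! n \<in> E" using len w(2) by auto
    then have "p (w ! n) = u (w ! n)" by (simp add: p v_def last)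
    then have "(\<Sum>a\<in>E. u a - p a) = - int n" using total[of p] pre[of n] by simp
    moreover have "\<forall>k<n. c k p = - int (Suc k)" unfolding c_def using pre by auto
    ultimately show "(\<forall>a. a \<notin> E \<longrightarrow> p a = 0) \<and> (\<Sum>a\<in>E. u a - p a) = - int n \<and> (\<forall>k<n. c k p = - int (Suc k))"
      by (simp add: p v_def)
  qed
  have "F n = delta v"
    unfolding F_def iff delta_def by (simp add: fun_eq_iff)
  then show ?thesis using iter[of n] by (simp add: v_def)
qed


section \<open>Evaluation of the leading coefficient\<close>

lemma esym_0 [simp]: "finite A \<Longrightarrow> esym 0 A v = 1"
proof -
  assume "finite A"
  then have "{S. S \<subseteq> A \<and> card S = 0} = {{}}" by (auto dest: finite_subset)
  then show ?thesis by (simp add: esym_def)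
qed

lemma esym_card:
  assumes "finite A"
  shows "esym (card A) A v = (\<Prod>a\<in>A. v a)"
proof -
  have "{S. S \<subseteq> A \<and> card S = card A} = {A}" using assms card_subset_eq by auto
  then show ?thesis by (simp add: esym_def)
qed

lemma esym_insert:
  assumes "finite A" "x \<notin> A"
  shows "esym (Suc k) (insert x A) v = esym (Suc k) A v + v x * esym k A v"
proof -
  let ?P = "{S. S \<subseteq> A \<and> card S = Suc k}" and ?Q = "{S. S \<subseteq> A \<and> card S = k}"
  have inj: "inj_on (insert x) ?Q"
    using assms(2) by (intro inj_onI) (auto simp: insert_eq_iff)
  have "{S. S \<subseteq> insert x A \<and> card S = Suc k} = ?P \<union> insert x ` ?Q"
  proof (intro equalityI subsetI)
    fix S assume S: "S \<in> {S. S \<subseteq> insert x A \<and> card S = Suc k}"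
    show "S \<in> ?P \<union> insert x ` ?Q"
    proof (cases "x \<in> S")
      case True
      have "finite S" using S assms(1) finite_subset by auto
      then have "S - {x} \<in> ?Q" using S True by auto
      moreover have "S = insert x (S - {x})" using True by auto
      ultimately show ?thesis by blast
    qed (use S in auto)
  next
    fix S assume "S \<in> ?P \<union> insert x ` ?Q"
    then show "S \<in> {S. S \<subseteq> insert x A \<and> card S = Suc k}"
      using assms finite_subset[of _ A] by (auto simp: card_insert_if)
  qed
  moreover have "(\<Sum>S\<in>?P \<union> insert x ` ?Q. \<Prod>a\<in>S. v a) =
      (\<Sum>S\<in>?P. \<Prod>a\<in>S. v a) + (\<Sum>S\<in>insert x ` ?Q. \<Prod>a\<in>S. v a)"
    using assms by (intro sum.union_disjoint) auto
  moreover have "(\<Sum>S\<in>insert x ` ?Q. \<Prod>a\<in>S. v a) = (\<Sum>S\<in>?Q. \<Prod>a\<in>insert x S. v a)"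
    by (simp add: sum.reindex[OF inj])
  moreover have "(\<Sum>S\<in>?Q. \<Prod>a\<in>insert x S. v a) = (\<Sum>S\<in>?Q. v x * (\<Prod>a\<in>S. v a))"
  proof (rule sum.cong[OF refl])
    fix S assume "S \<in> ?Q"
    then have "finite S" "x \<notin> S" using assms finite_subset[of S A] by auto
    then show "(\<Prod>a\<in>insert x S. v a) = v x * (\<Prod>a\<in>S. v a)" by simp
  qed
  ultimately show ?thesis by (simp add: esym_def sum_distrib_left)
qed

text \<open>In terms of generating functions, the powers of \<open>- v x\<close> form the inverse of
  the linear factor that \<open>x\<close> contributes.\<close>

lemma alternating_sum_esym:
  assumes "finite A" "x \<notin> A"
  shows "(\<Sum>j<Suc k. (- v x) ^ j * esym (k - j) (insert x A) v) = esym k A v"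
proof (induction k)
  case 0
  then show ?case using assms by simp
next
  case (Suc k)
  have "(\<Sum>j<Suc (Suc k). (- v x) ^ j * esym (Suc k - j) (insert x A) v) =
      esym (Suc k) (insert x A) v - v x * (\<Sum>j<Suc k. (- v x) ^ j * esym (k - j) (insert x A) v)"
    by (subst sum.lessThan_Suc_shift) (simp add: sum_distrib_left mult.assoc sum_negf del: sum.lessThan_Suc)
  also have "\<dots> = esym (Suc k) A v"
    unfolding Suc.IH esym_insert[OF assms] by simp
  finally show ?case .
qed

section \<open>The excess function and the reduction to a sum over orderings\<close>

context matroid
begin

text \<open>This is the function \<open>h p\<close> of the overview. Nonnegative excess for
  \<open>p = 0\<close> means crowded.\<close>

definition excess :: "('a \<Rightarrow> int) \<Rightarrow> 'a set \<Rightarrow> int" where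
  "excess p S = int (card S) - 2 * int (rk S) - (\<Sum>a\<in>S. p a)"

lemma excess_supermodular:
  assumes "S \<subseteq> E" "T \<subseteq> E"
  shows "excess p S + excess p T \<le> excess p (S \<union> T) + excess p (S \<inter> T)"
proof -
  have fin: "finite S" "finite T" using assms finite_ground finite_subset by blast+
  have "card (S \<union> T) + card (S \<inter> T) = card S + card T"
    using card_Un_Int[OF fin] by simp
  moreover have "(\<Sum>a\<in>S \<union> T. p a) + (\<Sum>a\<in>S \<inter> T. p a) = (\<Sum>a\<in>S. p a) + (\<Sum>a\<in>T. p a)"
    using fin by (rule sum.union_inter)
  ultimately show ?thesis
    using rank_submodular[of S T] unfolding excess_def by linarith
qed

lemma chain_char_excess_nonzero:
  assumes "inj_on idx E" "excess p E = 0" "chain_char idx {S. S \<subseteq> E \<and> excess p S \<ge> 0} E \<noteq> 0"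
  shows "S \<subseteq> E \<Longrightarrow> excess p S \<le> 0" and "S \<subseteq> E \<Longrightarrow> excess p S = 0 \<Longrightarrow> excess p (E - S) = 0"
proof -
  have "excess p {} = 0" by (simp add: excess_def)
  note * = supermodular_chain_char_nonzero[OF finite_ground assms(1) this assms(2)
      excess_supermodular assms(3)]
  show "S \<subseteq> E \<Longrightarrow> excess p S \<le> 0" "S \<subseteq> E \<Longrightarrow> excess p S = 0 \<Longrightarrow> excess p (E - S) = 0"
    by (rule *; simp)+
qed

text \<open>A nonzero \<open>p\<close> of total 0 is negative at some \<open>e\<close>. As
  \<open>e\<close> is no loop, the bound on the excess of \<open>{e}\<close> forces
  \<open>p e = -1\<close>, so \<open>{e}\<close> is a zero; as \<open>e\<close> is no coloop, its
  complement has excess -2 and is not one.\<close>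

lemma chain_char_excess_eq_0:
  assumes idx: "inj_on idx E" and card: "card E = 2 * rk E"
    and no: "\<And>e. e \<in> E \<Longrightarrow> \<not> is_loop E indep e \<and> \<not> is_coloop E indep e"
    and p: "\<And>a. a \<notin> E \<Longrightarrow> p a = 0" "(\<Sum>a\<in>E. p a) = 0" "p \<noteq> (\<lambda>_. 0)"
  shows "chain_char idx {S. S \<subseteq> E \<and> excess p S \<ge> 0} E = 0"
proof (rule ccontr)
  assume nz: "\<not> ?thesis"
  have "excess p E = 0" using card p(2) by (simp add: excess_def)
  note * = chain_char_excess_nonzero[OF idx this nz]
  have "\<exists>e\<in>E. p e < 0"
  proof (rule ccontr)
    assume "\<not> (\<exists>e\<in>E. p e < 0)"
    then have nonneg: "0 \<le> p e" if "e \<in> E" for e using that by force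
    have "\<forall>e\<in>E. p e = 0"
      using p(2) sum_nonneg_eq_0_iff[OF finite_ground nonneg] by simp
    with p show False by auto
  qed
  then obtain e where e: "e \<in> E" "p e < 0" by blast
  have "rk {e} = 1"
    using no[OF e(1)] rank_le_card[of "{e}"] e(1) by (auto simp: loop_iff_rank)
  then have ex_e: "excess p {e} = - 1 - p e" by (simp add: excess_def)
  then have "excess p {e} = 0" using *(1)[of "{e}"] e by simp
  then have "p e = - 1" "excess p (E - {e}) = 0" using *(2)[of "{e}"] e ex_e by auto
  moreover have "rk (E - {e}) = rk E"
    using no[OF e(1)] e(1) rank_mono[of "E - {e}" E] by (auto simp: coloop_iff_rank)
  moreover have "card E = Suc (card (E - {e}))"
    using card_Suc_Diff1[OF finite_ground e(1)] by simp
  moreover have "(\<Sum>a\<in>E - {e}. p a) = - p e"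
    using p(2) e finite_ground by (simp add: sum_diff1)
  ultimately show False using card by (simp add: excess_def)
qed

lemma last_notin_greedy_basis:
  assumes w: "w \<in> permutations_of_set E" "w \<noteq> []" and no: "\<not> is_coloop E indep (last w)"
  shows "last w \<notin> greedy_basis indep w"
proof
  note dw = permutations_of_setD[OF w(1)]
  obtain v a where v: "w = v @ [a]" using w(2) by (meson rev_exhaust)
  assume "last w \<in> greedy_basis indep w"
  then obtain k where k: "a = w ! k" "k < length w"
      "rk (set (take k w)) < rk (set (take (Suc k) w))"
    by (auto simp: greedy_basis_def v)
  have "w ! length v = a" "length v < length w" by (simp_all add: v)
  with k dw have "k = length v" by (metis nth_eq_iff_index_eq)
  moreover have "take (length v) w = v" "take (Suc (length v)) w = w" by (simp_all add: v)
  ultimately have "rk (set v) < rk E" using k(3) dw(1) by simp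
  moreover have "a \<in> E" "E - {a} = set v" using dw v by auto
  ultimately show False using no by (simp add: v coloop_iff_rank)
qed

lemma g_coeff_sum_rank:
  assumes card: "card E = 2 * rk E" and "E \<noteq> {}" and no: "\<And>e. e \<in> E \<Longrightarrow> \<not> is_coloop E indep e"
  shows "(-1) ^ rk E * g_coeff_sum E indep (rk E) = (\<Sum>w\<in>permutations_of_set E.
    Fract ((\<Prod>a\<in>E - greedy_basis indep w - {last w}. zvar a) * (\<Prod>a\<in>E - greedy_basis indep w. zvar a))
      (\<Prod>k<card E - 1. zvar (w ! k) - zvar (w ! Suc k)))"
proof -
  let ?r = "rk E"
  let ?B = "greedy_basis indep"
  let ?d = "\<lambda>w. \<Prod>k<card E - 1. zvar (w ! k) - zvar (w ! Suc k)"
  let ?f = "\<lambda>w j. (- zvar (last w)) ^ j * esym (?r - j - 1) (E - ?B w) zvar * esym (?r - ?r) (?B w) zvar *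
      esym (card E - ?r) (E - ?B w) (\<lambda>c. - zvar c)"
  have rpos: "?r > 0" using assms(2) finite_ground card by (metis card_gt_0_iff mult_0_right neq0_conv)
  then obtain m where m: "?r = Suc m" by (cases ?r) auto
  have num: "(\<Sum>j<?r. ?f w j) = (-1) ^ ?r *
      ((\<Prod>a\<in>E - ?B w - {last w}. zvar a) * (\<Prod>a\<in>E - ?B w. zvar a))"
    if w: "w \<in> permutations_of_set E" for w
  proof -
    note dw = permutations_of_setD[OF w]
    have ne: "w \<noteq> []" using dw assms(2) by auto
    then have last: "last w \<in> E" using dw by auto
    then have lastB: "last w \<notin> ?B w" using last_notin_greedy_basis[OF w ne] no by blast
    have BE: "?B w \<subseteq> E" using greedy_basis_subset dw by blast
    have finB: "finite (?B w)" using BE finite_ground finite_subset by blast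
    have "card (?B w) = ?r"
      using card_greedy_basis_prefix[of w "length w"] dw BE by (simp add: Int_absorb1)
    then have cardC: "card (E - ?B w) = ?r"
      using card BE finite_ground finB by (simp add: card_Diff_subset)
    define C where "C = E - ?B w - {last w}"
    have finC: "finite C" "last w \<notin> C" by (auto simp: C_def finite_ground)
    have insC: "E - ?B w = insert (last w) C" using last lastB by (auto simp: C_def)
    \<comment> \<open>Hence the telescoped polynomial of degree \<open>m\<close> in the variables of
      \<open>C\<close> is the full product.\<close>
    have "card C = m" using cardC finC m by (simp add: insC)
    have "esym (card E - ?r) (E - ?B w) (\<lambda>c. - zvar c) = (-1) ^ ?r * (\<Prod>a\<in>E - ?B w. zvar a)"
      using esym_card[of "E - ?B w" "\<lambda>c. - zvar c"] finite_ground cardC card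
      by (simp add: prod_uminus)
    then have "(\<Sum>j<?r. ?f w j) = (\<Sum>j<Suc m. (- zvar (last w)) ^ j * esym (m - j) (insert (last w) C) zvar) *
        ((-1) ^ ?r * (\<Prod>a\<in>E - ?B w. zvar a))"
      unfolding sum_distrib_right
      by (intro sum.cong) (auto simp: m insC[symmetric] esym_0[OF finB] mult.assoc)
    also have "(\<Sum>j<Suc m. (- zvar (last w)) ^ j * esym (m - j) (insert (last w) C) zvar) = (\<Prod>a\<in>C. zvar a)"
      unfolding alternating_sum_esym[OF finC] using esym_card[OF finC(1), of zvar] \<open>card C = m\<close> by simp
    finally show ?thesis by (simp add: C_def mult_ac)
  qed
  have "g_coeff_sum E indep ?r = (\<Sum>j<?r. \<Sum>w\<in>permutations_of_set E. Fract (?f w j) (?d w))"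
    by (simp add: g_coeff_sum_def deg_def Let_def)
  also have "\<dots> = (\<Sum>w\<in>permutations_of_set E. Fract (\<Sum>j<?r. ?f w j) (?d w))"
    by (subst sum.swap) (simp add: sum_Fract)
  also have "\<dots> = (\<Sum>w\<in>permutations_of_set E. (-1) ^ ?r *
      Fract ((\<Prod>a\<in>E - ?B w - {last w}. zvar a) * (\<Prod>a\<in>E - ?B w. zvar a)) (?d w))"
  proof (rule sum.cong[OF refl])
    fix w assume "w \<in> permutations_of_set E"
    have "(-1) ^ k * Fract x y = Fract ((-1) ^ k * x) y" for k and x y :: "'a zpoly"
      by (cases "even k") (auto simp: uminus_add_conv_diff)
    then show "Fract (\<Sum>j<?r. ?f w j) (?d w) = (-1) ^ ?r *
        Fract ((\<Prod>a\<in>E - ?B w - {last w}. zvar a) * (\<Prod>a\<in>E - ?B w. zvar a)) (?d w)"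
      by (simp only: num[OF \<open>w \<in> permutations_of_set E\<close>])
  qed
  finally have "(-1) ^ ?r * g_coeff_sum E indep ?r = (-1) ^ ?r * ((-1) ^ ?r *
      (\<Sum>w\<in>permutations_of_set E.
        Fract ((\<Prod>a\<in>E - ?B w - {last w}. zvar a) * (\<Prod>a\<in>E - ?B w. zvar a)) (?d w)))"
    by (simp add: sum_distrib_left)
  then show ?thesis by (simp add: mult.assoc[symmetric] power_add[symmetric])
qed

text \<open>Each summand of the g-polynomial is a monomial, so only \<open>i = rk E\<close>
  counts.\<close>

lemma omega_no_loops_coloops:
  assumes "E \<noteq> {}" "rk E > 0" and no: "\<And>e. e \<in> E \<Longrightarrow> \<not> is_loop E indep e \<and> \<not> is_coloop E indep e"
  shows "omega E indep = (-1) ^ card (components E indep) * ((-1) ^ rk E * g_coeff_sum E indep (rk E))"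
proof -
  have pow: "(- [:0, 1:]) ^ i = (monom ((-1) ^ i) i :: 'a zpoly fract poly)" for i
    by (induction i) (auto simp: mult_monom[symmetric] monom_altdef)
  have sign: "coeff ((-1) ^ k * q) i = (-1) ^ k * coeff q i" for k i and q :: "'a zpoly fract poly"
    by (cases "even k") auto
  have "\<not> (\<exists>e. is_loop E indep e \<or> is_coloop E indep e)"
    using no by (auto simp: is_loop_def is_coloop_def)
  then have "omega E indep = (-1) ^ card (components E indep) *
      (\<Sum>i=1..rk E. coeff (smult (g_coeff_sum E indep i) ((- [:0, 1:]) ^ i)) (rk E))"
    using assms(1) by (simp add: omega_def g_poly_def sign coeff_sum)
  also have "(\<Sum>i=1..rk E. coeff (smult (g_coeff_sum E indep i) ((- [:0, 1:]) ^ i)) (rk E)) =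
      (\<Sum>i=1..rk E. if i = rk E then (-1) ^ rk E * g_coeff_sum E indep (rk E) else 0)"
    by (intro sum.cong refl, simp only: pow coeff_smult coeff_monom) auto
  finally show ?thesis using assms(2) by simp
qed

text \<open>The coefficient of the expanded sum at \<open>p\<close> is minus the
  \<open>chain_char\<close> for \<open>excess p\<close>. It vanishes at every nonzero
  \<open>p\<close>, so the sum is the constant coefficient.\<close>

lemma flag_sum:
  assumes idx: "inj_on idx E" and card: "card E = 2 * rk E" and "E \<noteq> {}"
    and no: "\<And>e. e \<in> E \<Longrightarrow> \<not> is_loop E indep e \<and> \<not> is_coloop E indep e"
  shows "(\<Sum>w\<in>permutations_of_set E.
    Fract ((\<Prod>a\<in>E - greedy_basis indep w - {last w}. zvar a) * (\<Prod>a\<in>E - greedy_basis indep w. zvar a))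
      (\<Prod>k<card E - 1. zvar (w ! k) - zvar (w ! Suc k))) =
    of_int (- chain_char idx {S. S \<subseteq> E \<and> excess (\<lambda>_. 0) S \<ge> 0} E)"
proof -
  let ?B = "greedy_basis indep"
  define n where "n = card E - 1"
  \<comment> \<open>The parity decides the sign when all \<open>n\<close> factors are negated to
    match \<open>chain_weight\<close>.\<close>
  have "odd n"
    using assms(3) card finite_ground unfolding n_def by (cases "rk E") auto
  \<comment> \<open>The exponents of the numerator after a factor \<open>zvar (w ! k)\<close> has
    been divided out for each of the \<open>n\<close> denominators: 1 off the greedy basis and -1 on
    it, also at \<open>last w\<close>, which loses no factor.\<close>
  define u where "u = (\<lambda>w a. 1 - 2 * of_bool (a \<in> ?B w) :: int)"
  \<comment> \<open>With this choice every geometric series runs in powers of the variable of larger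
    \<open>idx\<close> over that of smaller \<open>idx\<close>, whatever \<open>w\<close>
    is.\<close>
  define b where "b = (\<lambda>w k. of_bool (idx (w ! Suc k) < idx (w ! k)) :: int)"
  define s where "s = (\<lambda>w p. if (\<forall>a. a \<notin> E \<longrightarrow> p a = 0) \<and> (\<Sum>a\<in>E. u w a - p a) = 0
     then \<Prod>k<n. of_bool ((\<Sum>a\<in>set (take (Suc k) w). u w a - p a) \<ge> 0) - b w k else 0)"
  \<comment> \<open>A prefix meets the greedy basis in as many elements as its rank, so the partial
    sums do not depend on the order within the prefix.\<close>
  have excess: "(\<Sum>a\<in>set (take k w). u w a - p a) = excess p (set (take k w))"
    if "w \<in> permutations_of_set E" "k \<le> length w" for w k p
  proof -
    have "int (card (set (take k w) \<inter> ?B w)) = int (rk (set (take k w)))"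
      using card_greedy_basis_prefix[of w k] that permutations_of_setD[OF that(1)] by simp
    then show ?thesis
      by (simp add: u_def excess_def sum_subtractf sum_distrib_left[symmetric] Int_def)
  qed
  have "(\<Sum>w\<in>permutations_of_set E. Fract ((\<Prod>a\<in>E - ?B w - {last w}. zvar a) * (\<Prod>a\<in>E - ?B w. zvar a))
      (\<Prod>k<n. zvar (w ! k) - zvar (w ! Suc k))) =
    of_int (- chain_char idx {S. S \<subseteq> E \<and> excess (\<lambda>_. 0) S \<ge> 0} E)"
  proof (rule sum_Fract_eq_of_int)
    fix w assume w: "w \<in> permutations_of_set E"
    note dw = permutations_of_setD[OF w]
    have ne: "w \<noteq> []" using dw assms(3) by auto
    have len: "length w - 1 = n" using dw distinct_card[of w] by (simp add: n_def)
    show "(\<Prod>k<n. zvar (w ! k) - zvar (w ! Suc k)) \<noteq> 0"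
      using dw len by (auto simp: nth_eq_iff_index_eq)
    have lastE: "last w \<in> E" using ne dw by auto
    then have lastB: "last w \<notin> ?B w" using last_notin_greedy_basis[OF w ne] no by blast
    have "act (\<Prod>k<n. zvar (w ! k) - zvar (w ! Suc k)) (s w) =
        delta (\<lambda>a. if a \<in> E then u w a + of_bool (a \<noteq> last w) else 0)"
      using act_prod_differences[OF dw(2,1) ne, of "u w" "b w"] unfolding len s_def .
    also have "(\<lambda>a. if a \<in> E then u w a + of_bool (a \<noteq> last w) else 0) =
        (\<lambda>a. of_bool (a \<in> E - ?B w) + of_bool (a \<in> E - ?B w - {last w}))"
      using lastE lastB greedy_basis_subset[of w] dw by (auto simp: u_def fun_eq_iff)
    also have "delta \<dots> = act ((\<Prod>a\<in>E - ?B w - {last w}. zvar a) * (\<Prod>a\<in>E - ?B w. zvar a)) (delta (\<lambda>_. 0))"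
      by (simp add: fun_eq_iff act_mult act_prod_zvar_delta finite_ground)
    finally show "act ((\<Prod>a\<in>E - ?B w - {last w}. zvar a) * (\<Prod>a\<in>E - ?B w. zvar a)) (delta (\<lambda>_. 0)) =
        act (\<Prod>k<n. zvar (w ! k) - zvar (w ! Suc k)) (s w)"
      by simp
  next
    fix p :: "'a \<Rightarrow> int"
    show "(\<Sum>w\<in>permutations_of_set E. s w p) =
        - chain_char idx {S. S \<subseteq> E \<and> excess (\<lambda>_. 0) S \<ge> 0} E * delta (\<lambda>_. 0) p"
    proof (cases "(\<forall>a. a \<notin> E \<longrightarrow> p a = 0) \<and> (\<Sum>a\<in>E. p a) = 0")
      case True
      define A where "A = {S. S \<subseteq> E \<and> excess p S \<ge> 0}"
      have "s w p = - chain_weight idx A w" if w: "w \<in> permutations_of_set E" for w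
      proof -
        note dw = permutations_of_setD[OF w]
        have len: "length w - 1 = n" using dw distinct_card[of w] by (simp add: n_def)
        have "(\<Sum>a\<in>E. u w a - p a) = excess p E"
          using excess[OF w order_refl, of p] dw by simp
        also have "\<dots> = 0" using True card by (simp add: excess_def)
        finally have "s w p = (\<Prod>k<n. of_bool ((\<Sum>a\<in>set (take (Suc k) w). u w a - p a) \<ge> 0) - b w k)"
          using True by (simp add: s_def)
        also have "\<dots> = (\<Prod>k<n. - (b w k - of_bool (set (take (Suc k) w) \<in> A)))"
        proof (rule prod.cong[OF refl])
          fix k assume "k \<in> {..<n}"
          then have "Suc k \<le> length w" using len by auto
          moreover have "set (take (Suc k) w) \<subseteq> E" using dw set_take_subset by metis
          ultimately show "of_bool ((\<Sum>a\<in>set (take (Suc k) w). u w a - p a) \<ge> 0) - b w k =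
              - (b w k - of_bool (set (take (Suc k) w) \<in> A))"
            by (simp add: excess[OF w] A_def)
        qed
        also have "\<dots> = - chain_weight idx A w"
          unfolding prod_uminus using \<open>odd n\<close> by (simp add: chain_weight_def b_def len[simplified])
        finally show ?thesis .
      qed
      then have "(\<Sum>w\<in>permutations_of_set E. s w p) = - chain_char idx A E"
        using assms(3) by (simp add: chain_char_def sum_negf)
      moreover have "chain_char idx A E = 0" if "p \<noteq> (\<lambda>_. 0)"
        unfolding A_def by (rule chain_char_excess_eq_0[OF idx card no]) (use True that in auto)
      ultimately show ?thesis by (cases "p = (\<lambda>_. 0)") (auto simp: A_def delta_def)
    next
      case False
      have "s w p = 0" if w: "w \<in> permutations_of_set E" for w
      proof -
        have "(\<Sum>a\<in>E. u w a - p a) = excess p E"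
          using excess[OF w order_refl, of p] permutations_of_setD[OF w] by simp
        also have "\<dots> = - (\<Sum>a\<in>E. p a)" using card by (simp add: excess_def)
        finally show ?thesis using False by (auto simp: s_def)
      qed
      moreover have "p \<noteq> (\<lambda>_. 0)" using False by auto
      ultimately show ?thesis by (simp add: delta_def)
    qed
  qed simp
  then show ?thesis by (simp add: n_def)
qed

section \<open>Crowded sets and components\<close>

lemma crowded_restriction_iff:
  "crowded C (restriction indep C) S \<longleftrightarrow> S \<subseteq> C \<and> excess (\<lambda>_. 0) S \<ge> 0"
  by (auto simp: crowded_def excess_def rank_restriction)

lemma excess_direct_sum:
  assumes "C \<in> components E indep" "S \<subseteq> E"
  shows "excess (\<lambda>_. 0) S = excess (\<lambda>_. 0) (S \<inter> C) + excess (\<lambda>_. 0) (S - C)"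
proof -
  have finS: "finite S" using assms finite_ground finite_subset by blast
  have "rk S = rk (S \<inter> C) + rk (S - C)"
    using assms by (intro rank_direct_sum) (auto simp: components_altdef)
  moreover have "card S = card (S \<inter> C) + card (S - C)"
    using finS by (simp add: card_Int_Diff)
  ultimately show ?thesis by (simp add: excess_def)
qed

text \<open>Under the condition the crowded sets form the Boolean lattice of unions of components.
  Otherwise the closure of zeros under complement fails, which forces the value 0.\<close>

lemma chain_char_excess_iff:
  assumes idx: "inj_on idx E" and card: "card E = 2 * rk E"
  shows "chain_char idx {S. S \<subseteq> E \<and> excess (\<lambda>_. 0) S \<ge> 0} E =
    (if \<forall>C\<in>components E indep. excess (\<lambda>_. 0) C = 0 \<and>
          \<not> (\<exists>S. S \<noteq> {} \<and> S \<noteq> C \<and> S \<subseteq> C \<and> excess (\<lambda>_. 0) S \<ge> 0)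
     then - ((-1) ^ card (components E indep)) else 0)"
proof -
  let ?h = "excess (\<lambda>_. 0)"
  let ?K = "components E indep"
  let ?A = "{S. S \<subseteq> E \<and> ?h S \<ge> 0}"
  define cond where "cond \<longleftrightarrow> (\<forall>C\<in>?K. ?h C = 0 \<and> \<not> (\<exists>S. S \<noteq> {} \<and> S \<noteq> C \<and> S \<subseteq> C \<and> ?h S \<ge> 0))"
  have h0: "?h {} = 0" by (simp add: excess_def)
  have hE: "?h E = 0" using card by (simp add: excess_def)
  have K_sub: "C \<subseteq> E" if "C \<in> ?K" for C using that by (simp add: components_altdef)
  have pos: "chain_char idx ?A E = - ((-1) ^ card ?K)" if cond
  proof -
    have part: "?h (S \<inter> C) \<le> 0 \<and> (?h (S \<inter> C) = 0 \<longrightarrow> S \<inter> C = {} \<or> S \<inter> C = C)" if "C \<in> ?K" for S C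
      using \<open>cond\<close> that h0 unfolding cond_def by (metis Int_lower2 linorder_not_le order_le_less)
    \<comment> \<open>Components are split off one at a time; the excess is additive and nonpositive
      on each piece, so it vanishes only if every piece is empty or a whole component.\<close>
    have decomp: "?h S \<le> 0 \<and> (?h S = 0 \<longrightarrow> (\<exists>J\<subseteq>?K. S = \<Union>J))" if "S \<subseteq> E" for S
      using that
    proof (induction "card S" arbitrary: S rule: less_induct)
      case (less S)
      show ?case
      proof (cases "S = {}")
        case True
        then show ?thesis using h0 by auto
      next
        case False
        then obtain e where e: "e \<in> S" by blast
        then obtain C where C: "C \<in> ?K" "e \<in> C" using components_cover less.prems by blast
        have finS: "finite S" using less.prems finite_ground finite_subset by blast
        have "card (S - C) < card S"
          by (rule psubset_card_mono[OF finS]) (use e C in auto)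
        then have IH: "?h (S - C) \<le> 0" "?h (S - C) = 0 \<Longrightarrow> \<exists>J\<subseteq>?K. S - C = \<Union>J"
          using less.hyps[of "S - C"] less.prems by auto
        note sum = excess_direct_sum[OF C(1) less.prems]
        have "\<exists>J\<subseteq>?K. S = \<Union>J" if "?h S = 0"
        proof -
          have "?h (S \<inter> C) = 0" "?h (S - C) = 0" using part[OF C(1), of S] IH(1) sum that by auto
          then obtain J where J: "J \<subseteq> ?K" "S - C = \<Union>J" and "S \<inter> C = C"
            using part[OF C(1), of S] IH(2) e C by blast
          then have "S = \<Union>(insert C J)" by auto
          with J C show ?thesis by (metis insert_subset)
        qed
        then show ?thesis using part[OF C(1), of S] IH(1) sum by auto
      qed
    qed
    have unions: "?h (\<Union>J) = 0" if "J \<subseteq> ?K" for J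
    proof -
      have "finite J" using that finite_components finite_subset by blast
      then show ?thesis using that
      proof (induction J)
        case (insert C J)
        have "C \<inter> \<Union>J = {}"
          using insert components_disjoint[of C] by blast
        then have "\<Union>(insert C J) \<inter> C = C" "\<Union>(insert C J) - C = \<Union>J" by auto
        moreover have "\<Union>(insert C J) \<subseteq> E" using insert K_sub by blast
        moreover have "?h C = 0" using insert.prems \<open>cond\<close> by (auto simp: cond_def)
        ultimately show ?case
          using excess_direct_sum[of C "\<Union>(insert C J)"] insert by auto
      qed (simp add: h0)
    qed
    have A: "?A = {\<Union>J |J. J \<subseteq> ?K}"
    proof (intro equalityI subsetI)
      fix S assume "S \<in> ?A"
      then show "S \<in> {\<Union>J |J. J \<subseteq> ?K}" using decomp[of S] by auto
    next
      fix S assume "S \<in> {\<Union>J |J. J \<subseteq> ?K}"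
      then obtain J where "S = \<Union>J" "J \<subseteq> ?K" by blast
      then show "S \<in> ?A" using unions K_sub by auto
    qed
    have EK: "E = \<Union>?K" using components_cover K_sub by blast
    have "chain_char idx {\<Union>J |J. J \<subseteq> ?K} (\<Union>?K) = - ((-1) ^ card ?K)"
    proof (rule chain_char_unions)
      show "inj_on idx (\<Union>?K)" using idx EK by simp
      show "C \<noteq> {} \<and> finite C" if "C \<in> ?K" for C
        using that K_sub finite_ground finite_subset by (auto simp: components_altdef)
    qed (use finite_components components_disjoint in auto)
    then show ?thesis using A EK by simp
  qed
  have neg: cond if nz: "chain_char idx ?A E \<noteq> 0"
    unfolding cond_def
  proof
    fix C assume C: "C \<in> ?K"
    note * = chain_char_excess_nonzero[OF idx hE nz]
    have CE: "C \<subseteq> E" and "C \<noteq> {}" using C by (auto simp: components_altdef)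
    have "E \<inter> C = C" using CE by auto
    \<comment> \<open>Two nonpositive numbers with sum 0 both vanish.\<close>
    then have "?h C + ?h (E - C) = 0" using excess_direct_sum[OF C order_refl] hE by simp
    then have hC: "?h C = 0" using *(1)[OF CE] *(1)[of "E - C"] by simp
    moreover have False if S: "S \<noteq> {}" "S \<noteq> C" "S \<subseteq> C" "?h S \<ge> 0" for S
    proof -
      have SE: "S \<subseteq> E" using S CE by auto
      have "?h S = 0" using *(1)[OF SE] S by simp
      moreover from this have "?h (E - S) = 0" using *(2)[OF SE] by simp
      moreover have "card E = card S + card (E - S)"
        using SE finite_ground by (metis card_Int_Diff inf.absorb2)
      \<comment> \<open>Zero excess on \<open>S\<close> and on its complement makes the ranks add
        up, so \<open>S\<close> would separate the connected set \<open>C\<close>.\<close>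
      ultimately have "rk S + rk (E - S) = rk E" using card by (simp add: excess_def)
      then have "C \<inter> S = {} \<or> C \<subseteq> S" using component_meets_summand[OF C SE] by simp
      with S show False by auto
    qed
    ultimately show "?h C = 0 \<and> \<not> (\<exists>S. S \<noteq> {} \<and> S \<noteq> C \<and> S \<subseteq> C \<and> ?h S \<ge> 0)" by blast
  qed
  have "chain_char idx ?A E = (if cond then - ((-1) ^ card ?K) else 0)"
    using pos neg by metis
  then show ?thesis by (simp only: cond_def)
qed

end

theorem proposition12p1:
  fixes E :: "'a set" and indep :: "'a set \<Rightarrow> bool"
  assumes "matroid E indep"
    and "card E = 2 * matroid_rank indep E"
  shows "(omega E indep = 1 \<or> omega E indep = 0) \<and>
    omega E indep =
      (if \<forall>C\<in>components E indep.
            card C = 2 * matroid_rank (restriction indep C) C \<and>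
            \<not> (\<exists>S. S \<noteq> {} \<and> S \<noteq> C \<and> crowded C (restriction indep C) S)
       then 1 else 0)"
proof -
  interpret matroid E indep by fact
  let ?P = "\<lambda>C. card C = 2 * matroid_rank (restriction indep C) C \<and>
            \<not> (\<exists>S. S \<noteq> {} \<and> S \<noteq> C \<and> crowded C (restriction indep C) S)"
  have "omega E indep = (if \<forall>C\<in>components E indep. ?P C then 1 else 0)"
  proof (cases "\<exists>e. is_loop E indep e \<or> is_coloop E indep e")
    case True
    then obtain e where e: "is_loop E indep e \<or> is_coloop E indep e" by blast
    then have comp: "{e} \<in> components E indep" by (rule loop_or_coloop_component)
    have "\<not> (\<forall>C\<in>components E indep. ?P C)"
    proof
      assume "\<forall>C\<in>components E indep. ?P C"
      \<comment> \<open>A one-element component has odd cardinality, so it cannot have twice its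
        rank many elements.\<close>
      from bspec[OF this comp] show False by simp
    qed
    moreover have "E \<noteq> {}" using e by (auto simp: is_loop_def is_coloop_def)
    then have "omega E indep = 0" using True by (simp add: omega_def g_poly_def)
    ultimately show ?thesis by (simp only: if_False)
  next
    case no: False
    show ?thesis
    proof (cases "E = {}")
      case True
      moreover then have "components E indep = {}" by (auto simp: components_def direct_summand_def)
      ultimately show ?thesis by (simp add: omega_def g_poly_def)
    next
      case False
      obtain idx :: "'a \<Rightarrow> nat" where idx: "inj_on idx E"
        using finite_imp_inj_to_nat_seg[OF finite_ground] by blast
      have rk: "rk E > 0" using False finite_ground assms(2) by (cases "rk E") auto
      have "omega E indep = (-1) ^ card (components E indep) *
          of_int (- chain_char idx {S. S \<subseteq> E \<and> excess (\<lambda>_. 0) S \<ge> 0} E)"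
      proof -
        have "omega E indep = (-1) ^ card (components E indep) * ((-1) ^ rk E * g_coeff_sum E indep (rk E))"
          by (rule omega_no_loops_coloops[OF False rk]) (use no in blast)
        also have "(-1) ^ rk E * g_coeff_sum E indep (rk E) = (\<Sum>w\<in>permutations_of_set E.
            Fract ((\<Prod>a\<in>E - greedy_basis indep w - {last w}. zvar a) * (\<Prod>a\<in>E - greedy_basis indep w. zvar a))
              (\<Prod>k<card E - 1. zvar (w ! k) - zvar (w ! Suc k)))"
          by (rule g_coeff_sum_rank[OF assms(2) False]) (use no in blast)
        also have "\<dots> = of_int (- chain_char idx {S. S \<subseteq> E \<and> excess (\<lambda>_. 0) S \<ge> 0} E)"
          by (rule flag_sum[OF idx assms(2) False]) (use no in blast)
        finally show ?thesis .
      qed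
      moreover have "(\<forall>C\<in>components E indep. ?P C) \<longleftrightarrow> (\<forall>C\<in>components E indep. excess (\<lambda>_. 0) C = 0 \<and>
          \<not> (\<exists>S. S \<noteq> {} \<and> S \<noteq> C \<and> S \<subseteq> C \<and> excess (\<lambda>_. 0) S \<ge> 0))"
        by (rule ball_cong[OF refl]) (auto simp: crowded_restriction_iff rank_restriction excess_def)
      \<comment> \<open>The sign of the Moebius function of the Boolean lattice cancels the sign in
        the definition of the g-polynomial.\<close>
      ultimately show ?thesis
        by (simp add: chain_char_excess_iff[OF idx assms(2)] power_add[symmetric])
    qed
  qed
  then show ?thesis by simp
qed

end
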